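(* Let $A$ be a $C^*$-algebra, $X$ a Hilbert $A$-module, $\mathcal{H},\mathcal{K}$ Hilbert spaces, $\varphi:A\to L(\mathcal{H})$ a completely positive linear map, $\Phi:X\to L(\mathcal{H},\mathcal{K})$ a $\varphi$-map and $x_0\in X$. Then: (1) $x_0\in X_\Phi$ if and only if $\langle x_0,x_0\rangle\in T_\varphi$; (2) $x_0\in X_\Phi$ if and only if $\Phi(x_0\langle y,z\rangle)=\Phi(x_0)\varphi(\langle y,z\rangle)$ for all $y,z\in X$; (3) $X_\Phi=T_\Phi$. Moreover, if $\varphi$ is contractive, then (4) $\Phi(x_0\langle x_0,x_0\rangle)=\Phi(x_0)\varphi(\langle x_0,x_0\rangle)$ if and only if $\langle x_0,x_0\rangle\in M_\varphi$.
   Context: Hilbert $C^*$-modules are right modules, with inner product linear in the second variable. $L(\mathcal{H},\mathcal{K})$ denotes the bounded linear operators from $\mathcal{H}$ to $\mathcal{K}$, and $L(\mathcal{H})=L(\mathcal{H},\mathcal{H})$. A map $\Phi:X\to L(\mathcal{H},\mathcal{K})$ is a $\varphi$-map if $\Phi(x)^*\Phi(y)=\varphi(\langle x,y\rangle)$ for all $x,y\in X$. Definitions: $M_\varphi=\{a\in A:\varphi(ab)=\varphi(a)\varphi(b)\text{ and }\varphi(ba)=\varphi(b)\varphi(a)\text{ for all }b\in A\}$ (multiplicative domain of $\varphi$); $T_\varphi=\{a\in M_\varphi:\varphi(ba^*c)=\varphi(b)\varphi(a)^*\varphi(c)\text{ for all }b,c\in A\}$ (ternary domain of $\varphi$); $X_\Phi=\{x\in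 X:\Phi(xb)=\Phi(x)\varphi(b)\text{ for all }b\in A\}$ ($\varphi$-module domain of $\Phi$); $T_\Phi=\{y\in X:\Phi(x\langle y,z\rangle)=\Phi(x)\Phi(y)^*\Phi(z)\text{ for all }x,z\in X\}$ (ternary domain of $\Phi$).
   Formalization: The "if" part of (2) and the inclusion of T_Φ in X_Φ in (3) are proved only when X is full or φ is contractive; without this they fail, e.g. for A=ℂ⊕ℂ, X=ℂ⊕0, φ(s,t)=s+t, Φ(x)=x, where X_Φ=0 but T_Φ=X. *)

theory Defs
  imports "HOL-Analysis.Analysis"
begin

section \<open>Complex Banach spaces, Hilbert spaces and \<open>C\<^sup>*\<close>-algebras\<close>

class scaleC =
  fixes scaleC :: "complex \<Rightarrow> 'a \<Rightarrow> 'a"  (infixr "*\<^sub>C" 75)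

class complex_normed_vector = scaleC + real_normed_vector +
  assumes scaleC_add_right: "c *\<^sub>C (x + y) = c *\<^sub>C x + c *\<^sub>C y"
    and scaleC_add_left: "(c + d) *\<^sub>C x = c *\<^sub>C x + d *\<^sub>C x"
    and scaleC_scaleC: "c *\<^sub>C (d *\<^sub>C x) = (c * d) *\<^sub>C x"
    and scaleR_scaleC: "r *\<^sub>R x = complex_of_real r *\<^sub>C x"
    and norm_scaleC: "norm (c *\<^sub>C x) = cmod c * norm x"

class complex_banach = complex_normed_vector + complete_space

text \<open>The algebras are not assumed to be unital.\<close>

class cstar_algebra = complex_banach + real_normed_algebra +
  fixes star :: "'a \<Rightarrow> 'a"
  assumes mult_scaleC_left: "(c *\<^sub>C a) * b = c *\<^sub>C (a * b)"
    and mult_scaleC_right: "a * (c *\<^sub>C b) = c *\<^sub>C (a * b)"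
    and star_add: "star (a + b) = star a + star b"
    and star_scaleC: "star (c *\<^sub>C a) = cnj c *\<^sub>C star a"
    and star_mult: "star (a * b) = star b * star a"
    and star_star: "star (star a) = a"
    and cstar_identity: "norm (star a * a) = (norm a)\<^sup>2"

class complex_hilbert = complex_banach +
  fixes cinner :: "'a \<Rightarrow> 'a \<Rightarrow> complex"
  assumes cinner_add_right: "cinner x (y + z) = cinner x y + cinner x z"
    and cinner_scaleC_right: "cinner x (c *\<^sub>C y) = c * cinner x y"
    and cnj_cinner: "cnj (cinner x y) = cinner y x"
    and cinner_self_nonneg: "cinner x x \<in> \<real>\<^sub>\<ge>\<^sub>0"
    and norm_cinner: "norm x = sqrt (cmod (cinner x x))"


section \<open>Bounded operators\<close>

text \<open>
  Operators are plain functions, so their product is \<open>\<circ>\<close>, and \<open>onorm\<close> is the operator norm.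
\<close>

definition bounded_ops :: "('h::complex_normed_vector \<Rightarrow> 'k::complex_normed_vector) set" where
  "bounded_ops = {f. bounded_linear f \<and> (\<forall>c x. f (c *\<^sub>C x) = c *\<^sub>C f x)}"

text \<open>Meaningful for members of \<open>bounded_ops\<close>, where the adjoint exists and is unique.\<close>

definition cadjoint :: "('h::complex_hilbert \<Rightarrow> 'k::complex_hilbert) \<Rightarrow> 'k \<Rightarrow> 'h" where
  "cadjoint f = (THE g. \<forall>h k. cinner (g k) h = cinner k (f h))"


section \<open>Hilbert modules\<close>

definition cstar_positive :: "'a::cstar_algebra \<Rightarrow> bool" where
  "cstar_positive a \<longleftrightarrow> (\<exists>b. a = star b * b)"

text \<open>Completeness comes from the class of \<open>'x\<close>, whose norm is the one induced by \<open>ip\<close>.\<close>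

locale hilbert_module =
  fixes act :: "'x::complex_banach \<Rightarrow> 'a::cstar_algebra \<Rightarrow> 'x"
    and ip :: "'x \<Rightarrow> 'x \<Rightarrow> 'a"
  assumes act_add_left: "act (x + y) a = act x a + act y a"
    and act_add_right: "act x (a + b) = act x a + act x b"
    and act_mult: "act x (a * b) = act (act x a) b"
    and act_scaleC_left: "act (c *\<^sub>C x) a = c *\<^sub>C act x a"
    and act_scaleC_right: "act x (c *\<^sub>C a) = c *\<^sub>C act x a"
    and ip_add_right: "ip x (y + z) = ip x y + ip x z"
    and ip_scaleC_right: "ip x (c *\<^sub>C y) = c *\<^sub>C ip x y"
    and ip_act_right: "ip x (act y a) = ip x y * a"
    and star_ip: "star (ip x y) = ip y x"
    and ip_self_positive: "cstar_positive (ip x x)"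
    and norm_ip: "norm x = sqrt (norm (ip x x))"

text \<open>
  The real linear span of the inner products is a complex subspace, since
  \<open>c *\<^sub>C ip x y = ip x (c *\<^sub>C y)\<close>.

  Testing against inner products alone cannot detect how \<open>\<phi>\<close> behaves off their closed span, so the
  module domain is determined by such tests only if the module is full or \<open>\<phi>\<close> is contractive.
  For \<open>A = \<complex> \<oplus> \<complex>\<close>, \<open>X = \<complex> \<oplus> 0\<close>, \<open>\<phi> (s, t) = s + t\<close> and \<open>\<Phi> (s, 0) = s\<close> the
  module domain is \<open>0\<close>, yet every \<open>x\<close> passes the tests and the ternary domain of \<open>\<Phi>\<close> is \<open>X\<close>.
\<close>

definition full_module :: "('x \<Rightarrow> 'x \<Rightarrow> 'a::cstar_algebra) \<Rightarrow> bool" where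
  "full_module ip \<longleftrightarrow> closure (span {ip x y | x y. True}) = UNIV"


section \<open>Completely positive maps and \<open>\<phi>\<close>-maps\<close>

text \<open>
  An \<open>n \<times> n\<close> matrix is a function of two indices, of which only the values below \<open>n\<close> matter.
  Positive in \<open>M\<^sub>n(A)\<close> means of the form \<open>b\<^sup>*b\<close>; positive in \<open>M\<^sub>n(L(H)) = L(H\<^sup>n)\<close> means
  positive as an operator on \<open>H\<^sup>n\<close>.
\<close>

definition positive_matrix :: "nat \<Rightarrow> (nat \<Rightarrow> nat \<Rightarrow> 'a::cstar_algebra) \<Rightarrow> bool" where
  "positive_matrix n a \<longleftrightarrow>
     (\<exists>b. \<forall>i<n. \<forall>j<n. a i j = (\<Sum>k<n. star (b k i) * b k j))"

definition positive_op_matrix ::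
  "nat \<Rightarrow> (nat \<Rightarrow> nat \<Rightarrow> 'h \<Rightarrow> 'h::complex_hilbert) \<Rightarrow> bool" where
  "positive_op_matrix n T \<longleftrightarrow>
     (\<forall>h. (\<Sum>i<n. \<Sum>j<n. cinner (h i) (T i j (h j))) \<in> \<real>\<^sub>\<ge>\<^sub>0)"

definition linear_op_map ::
  "('a::cstar_algebra \<Rightarrow> 'h \<Rightarrow> 'k::complex_normed_vector) \<Rightarrow> bool" where
  "linear_op_map \<phi> \<longleftrightarrow>
     (\<forall>a b. \<phi> (a + b) = (\<lambda>h. \<phi> a h + \<phi> b h)) \<and>
     (\<forall>c a. \<phi> (c *\<^sub>C a) = (\<lambda>h. c *\<^sub>C \<phi> a h))"

definition completely_positive ::
  "('a::cstar_algebra \<Rightarrow> 'h \<Rightarrow> 'h::complex_hilbert) \<Rightarrow> bool" where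
  "completely_positive \<phi> \<longleftrightarrow>
     (\<forall>n a. positive_matrix n a \<longrightarrow> positive_op_matrix n (\<lambda>i j. \<phi> (a i j)))"

definition contractive :: "('a::cstar_algebra \<Rightarrow> 'h \<Rightarrow> 'h::complex_hilbert) \<Rightarrow> bool" where
  "contractive \<phi> \<longleftrightarrow> (\<forall>a. onorm (\<phi> a) \<le> norm a)"

definition phi_map ::
  "('x \<Rightarrow> 'x \<Rightarrow> 'a) \<Rightarrow> ('a \<Rightarrow> 'h \<Rightarrow> 'h) \<Rightarrow> ('x \<Rightarrow> 'h::complex_hilbert \<Rightarrow> 'k::complex_hilbert) \<Rightarrow> bool"
  where
  "phi_map ip \<phi> \<Phi> \<longleftrightarrow> (\<forall>x y. cadjoint (\<Phi> x) \<circ> \<Phi> y = \<phi> (ip x y))"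


section \<open>Multiplicative, ternary and module domains\<close>

definition mult_domain :: "('a::cstar_algebra \<Rightarrow> 'h \<Rightarrow> 'h) \<Rightarrow> 'a set" where
  "mult_domain \<phi> = {a. \<forall>b. \<phi> (a * b) = \<phi> a \<circ> \<phi> b \<and> \<phi> (b * a) = \<phi> b \<circ> \<phi> a}"

definition ternary_domain :: "('a::cstar_algebra \<Rightarrow> 'h \<Rightarrow> 'h::complex_hilbert) \<Rightarrow> 'a set" where
  "ternary_domain \<phi> =
     {a \<in> mult_domain \<phi>. \<forall>b c. \<phi> (b * star a * c) = \<phi> b \<circ> cadjoint (\<phi> a) \<circ> \<phi> c}"

definition module_domain ::
  "('x \<Rightarrow> 'a \<Rightarrow> 'x) \<Rightarrow> ('a \<Rightarrow> 'h \<Rightarrow> 'h) \<Rightarrow> ('x \<Rightarrow> 'h \<Rightarrow> 'k) \<Rightarrow> 'x set" where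
  "module_domain act \<phi> \<Phi> = {x. \<forall>b. \<Phi> (act x b) = \<Phi> x \<circ> \<phi> b}"

definition module_ternary_domain ::
  "('x \<Rightarrow> 'a \<Rightarrow> 'x) \<Rightarrow> ('x \<Rightarrow> 'x \<Rightarrow> 'a) \<Rightarrow>
   ('x \<Rightarrow> 'h::complex_hilbert \<Rightarrow> 'k::complex_hilbert) \<Rightarrow> 'x set" where
  "module_ternary_domain act ip \<Phi> =
     {y. \<forall>x z. \<Phi> (act x (ip y z)) = \<Phi> x \<circ> cadjoint (\<Phi> y) \<circ> \<Phi> z}"

end

theory Submission
  imports Defs
begin

text \<open>
  Write \<open>a = ip x x\<close>. Because \<open>\<langle>\<Phi> x g, \<Phi> y h\<rangle> = \<langle>g, \<phi> (ip x y) h\<rangle>\<close>, every identity between vectors of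
  the form \<open>\<Phi> y h\<close> can be tested through \<open>\<phi>\<close>: expanding \<open>\<parallel>\<Phi> (act x b) h - \<Phi> x (\<phi> b h)\<parallel>\<^sup>2\<close> leaves
  only terms in \<open>\<phi>\<close>, and the vector vanishes as soon as \<open>\<phi>\<close> factorises at the products \<open>a b\<close> and
  \<open>b\<^sup>* a b\<close> (\<open>module_eqI\<close>). In the other direction a factorisation of
  \<open>\<Phi> (act x b)\<close> is read off as one of \<open>\<phi> (a b)\<close> and \<open>\<phi> (b\<^sup>* a c)\<close>. This settles the
  characterisation of the module domain by the ternary domain of \<open>\<phi>\<close> and the inclusion of the module
  domain in the ternary domain of \<open>\<Phi>\<close>, once \<open>\<phi>\<close> is known to preserve adjoints. It also shows that
  members of the ternary domain of \<open>\<Phi>\<close> pass the tests against inner products.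

  What remains is to pass from the span of the inner products to all of \<open>A\<close>. If the module is full,
  this is a density argument, and all it needs is that \<open>\<phi>\<close> is bounded (\<open>phi_weakly_bounded\<close>). If
  \<open>\<phi>\<close> is contractive, take an approximate unit \<open>e\<close> inside \<open>a A\<close>. Then \<open>\<Phi> (act x (e b)) = \<Phi> x \<phi> (e b)\<close>
  and \<open>act x e\<close> tends to \<open>x\<close>, so it is to be shown that \<open>\<Phi> x \<phi> (b - e b)\<close> tends to \<open>0\<close>. On vectors
  \<open>k = (\<Phi> x)\<^sup>* l\<close> one has \<open>\<phi> e k \<rightarrow> k\<close>, so the defect \<open>\<langle>k, \<phi> (e e) k\<rangle> - \<parallel>\<phi> e k\<parallel>\<^sup>2\<close> in the
  Kadison-Schwarz inequality tends to \<open>0\<close>, and Cauchy-Schwarz for this defect and for \<open>\<phi>\<close> gives the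
  claim (\<open>module_domain_if_contractive\<close>). If \<open>\<phi> (a a) = \<phi> a \<phi> a\<close>, this defect vanishes for
  \<open>a\<close> in place of \<open>e\<close> and every \<open>k\<close>, which by Choi's argument puts \<open>a\<close> into the multiplicative domain
  (\<open>mult_domain_if_square\<close>).

  Adjoint preservation and boundedness of \<open>\<phi>\<close> require order theory in an algebra without unit:
  every self-adjoint element is a difference of two squares (\<open>selfadj_diff_squares\<close>), a convergent
  convex combination of squares is a square (\<open>unit_pos_half_series\<close>), and approximate units exist
  (\<open>selfadj_approx_unit\<close>). All of it is derived without spectral theory from the binomial series of
  \<open>\<surd>(1 - w)\<close>, which converges absolutely for contractions \<open>w\<close>. The missing unit is replaced by
  the identity map, so that \<open>1 - t\<close> is the operator \<open>\<lambda>x. x - t * x\<close> on \<open>A\<close>.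
\<close>

section \<open>Elementary facts about \<open>C\<^sup>*\<close>-algebras\<close>

instance complex_banach \<subseteq> banach ..

lemma scaleC_one [simp]: "1 *\<^sub>C x = x" for x :: "'a::complex_normed_vector"
  using scaleR_scaleC[of 1 x] by simp

lemma scaleC_minus_one: "(-1) *\<^sub>C x = - x" for x :: "'a::complex_normed_vector"
  using scaleR_scaleC[of "-1" x] by simp

lemma bounded_linear_scaleC: "bounded_linear (\<lambda>x::'a::complex_normed_vector. c *\<^sub>C x)"
proof (rule bounded_linear_intro[where K = "cmod c"])
  fix x y :: 'a and r :: real
  show "c *\<^sub>C (x + y) = c *\<^sub>C x + c *\<^sub>C y"
    by (rule scaleC_add_right)
  show "c *\<^sub>C (r *\<^sub>R x) = r *\<^sub>R (c *\<^sub>C x)"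
    by (simp add: scaleR_scaleC scaleC_scaleC mult.commute)
  show "norm (c *\<^sub>C x) \<le> norm x * cmod c"
    by (simp add: norm_scaleC mult.commute)
qed

lemma scaleC_minus_left: "(- c) *\<^sub>C x = - (c *\<^sub>C x)" for x :: "'a::complex_normed_vector"
  using scaleC_scaleC[of "-1" c x] by (simp add: scaleC_minus_one)

lemmas scaleC_zero_right [simp] = bounded_linear.linear[OF bounded_linear_scaleC, THEN linear_0]
lemmas scaleC_diff_right = bounded_linear.linear[OF bounded_linear_scaleC, THEN linear_diff]

lemma star_zero [simp]: "star (0::'a::cstar_algebra) = 0"
  using star_add[of 0 "0::'a"] by simp

lemma star_minus: "star (- a) = - star (a::'a::cstar_algebra)"
  using star_scaleC[of "-1" a] by (simp add: scaleC_minus_one)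

lemma star_diff: "star (a - b) = star a - star (b::'a::cstar_algebra)"
  using star_add[of a "- b"] by (simp add: star_minus)

lemma star_scaleR: "star (r *\<^sub>R a) = r *\<^sub>R star (a::'a::cstar_algebra)"
  by (simp add: scaleR_scaleC star_scaleC)

lemma norm_star [simp]: "norm (star a) = norm (a::'a::cstar_algebra)"
proof -
  have le: "norm b \<le> norm (star b)" for b :: 'a
  proof (cases "b = 0")
    case False
    have "norm b * norm b \<le> norm (star b) * norm b"
      using norm_mult_ineq[of "star b" b] by (simp add: cstar_identity power2_eq_square)
    then show ?thesis
      using False by simp
  qed simp
  show ?thesis
    using le[of a] le[of "star a"] by (simp add: star_star)
qed

lemma bounded_linear_star: "bounded_linear (star :: 'a::cstar_algebra \<Rightarrow> 'a)"
  by (rule bounded_linear_intro[where K = 1]) (simp_all add: star_add star_scaleR)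

lemma star_mult_self_eq_0: "star a * a = 0 \<longleftrightarrow> a = (0::'a::cstar_algebra)"
  using cstar_identity[of a] by auto

lemma mult_star_self_eq_0: "a * star a = 0 \<longleftrightarrow> a = (0::'a::cstar_algebra)"
  using star_mult_self_eq_0[of "star a"] by (simp add: star_star) (metis star_star star_zero)

lemma eq_zero_if_right_mult: "(\<And>x. a * x = 0) \<Longrightarrow> a = (0::'a::cstar_algebra)"
  using mult_star_self_eq_0 by blast

lemma selfadj_norm_square: "star a = a \<Longrightarrow> norm (a * a) = (norm (a::'a::cstar_algebra))\<^sup>2"
  using cstar_identity[of a] by simp

lemma selfadj_nilpotent:
  assumes "star a = (a::'a::cstar_algebra)" "a * a * (a * a) = 0"
  shows "a = 0"
  using assms star_mult_self_eq_0[of "a * a"] star_mult_self_eq_0[of a] by (simp add: star_mult)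

lemma selfadj_real_part:
  fixes a :: "'a::cstar_algebra"
  obtains h k where "star h = h" "star k = k" "a = h + \<i> *\<^sub>C k"
    "star a = h - \<i> *\<^sub>C k" "norm h \<le> norm a" "norm k \<le> norm a"
proof
  let ?h = "(1/2) *\<^sub>R (a + star a)" and ?k = "(- \<i> / 2) *\<^sub>C (a - star a)"
  show "star ?h = ?h"
    by (simp add: star_scaleR star_add star_star add.commute)
  show "star ?k = ?k"
    by (simp add: star_scaleC star_diff star_star scaleC_diff_right scaleC_minus_left)
  have k: "\<i> *\<^sub>C ?k = (1/2) *\<^sub>R (a - star a)"
    by (simp add: scaleC_scaleC scaleR_scaleC)
  have 2: "(1/2) *\<^sub>R x + (1/2) *\<^sub>R x = x" for x :: 'a
    by (metis scaleR_half_double scaleR_right_distrib)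
  show "a = ?h + \<i> *\<^sub>C ?k"
    unfolding k by (simp add: scaleR_right_distrib scaleR_right_diff_distrib 2)
  show "star a = ?h - \<i> *\<^sub>C ?k"
    unfolding k by (simp add: scaleR_right_distrib scaleR_right_diff_distrib 2)
  show "norm ?h \<le> norm a"
    using norm_triangle_ineq[of a "star a"] by simp
  show "norm ?k \<le> norm a"
    using norm_triangle_ineq4[of a "star a"] by (simp add: norm_scaleC norm_divide)
qed

lemma tendsto_zero_if_norm_square:
  fixes f :: "'b \<Rightarrow> 'a::real_normed_vector"
  assumes "((\<lambda>x. (norm (f x))\<^sup>2) \<longlongrightarrow> 0) F"
  shows "(f \<longlongrightarrow> 0) F"
  using tendsto_real_sqrt[OF assms] by (simp add: tendsto_norm_zero_iff)

section \<open>The binomial series of the square root\<close>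

text \<open>
  The coefficients of \<open>\<surd>(1 - w)\<close>: the constant term is \<open>1\<close>, all others are nonpositive and add up to
  \<open>-1\<close>. That the signs agree is what turns estimates by \<open>\<bar>sqrt_coeff n\<bar>\<close> into sharp ones.
\<close>

definition sqrt_coeff :: "nat \<Rightarrow> real" where
  "sqrt_coeff n = (-1) ^ n * ((1/2) gchoose n)"

lemma sqrt_coeff_0 [simp]: "sqrt_coeff 0 = 1"
  by (simp add: sqrt_coeff_def)

lemma sqrt_coeff_Suc_nonpos: "sqrt_coeff (Suc n) \<le> 0"
proof (induction n)
  case (Suc n)
  define q where "q = (real (Suc n) - 1/2) / real (Suc (Suc n))"
  have "((1/2::real) gchoose Suc (Suc n)) = - q * ((1/2) gchoose Suc n)"
    using gbinomial_mult_1[of "1/2::real" "Suc n"] by (simp add: q_def field_simps)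
  then have "sqrt_coeff (Suc (Suc n)) = sqrt_coeff (Suc n) * q"
    by (simp add: sqrt_coeff_def)
  moreover have "0 \<le> q"
    by (simp add: q_def)
  ultimately show ?case
    using Suc by (simp add: mult_nonpos_nonneg)
qed (simp add: sqrt_coeff_def)

text \<open>
  Squaring the series gives \<open>1 - w\<close>, by the Vandermonde identity for \<open>1/2 + 1/2 = 1\<close>.
\<close>

lemma sqrt_coeff_convolution:
  "(\<Sum>i\<le>k. sqrt_coeff i * sqrt_coeff (k - i)) = (if k = 0 then 1 else if k = 1 then -1 else 0)"
proof -
  have "(\<Sum>i\<le>k. sqrt_coeff i * sqrt_coeff (k - i))
      = (\<Sum>i\<le>k. (-1)^k * (((1/2) gchoose i) * ((1/2) gchoose (k - i))))"
  proof (rule sum.cong)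
    fix i assume "i \<in> {..k}"
    then have "(-1::real)^k = (-1)^i * (-1)^(k-i)"
      by (simp flip: power_add)
    then show "sqrt_coeff i * sqrt_coeff (k - i)
        = (-1)^k * (((1/2) gchoose i) * ((1/2) gchoose (k - i)))"
      by (simp add: sqrt_coeff_def)
  qed simp
  also have "\<dots> = (-1)^k * (1 gchoose k)"
    using gbinomial_Vandermonde[of "1/2::real" "1/2" k]
    by (simp add: atLeast0AtMost flip: sum_distrib_left)
  also have "(1::real) gchoose k = of_nat (1 choose k)"
    by (metis binomial_gbinomial of_nat_1)
  also have "(-1)^k * real (1 choose k) = (if k = 0 then 1 else if k = 1 then -1 else 0)"
    by (cases k rule: nat.exhaust) (auto simp: binomial_eq_0)
  finally show ?thesis .
qed

text \<open>
  The partial sums telescope to \<open>(m - 1/2) gchoose m\<close>. As only the constant term is positive, their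
  being nonnegative bounds the sum of the absolute values by \<open>2\<close>.
\<close>

lemma sqrt_coeff_partial_sum_nonneg: "0 \<le> (\<Sum>k\<le>m. sqrt_coeff k)"
proof -
  have "(\<Sum>k\<le>m. sqrt_coeff k) = (-1)^m * ((-1/2) gchoose m)"
    using gbinomial_sum_lower_neg[of "1/2::real" m]
    by (simp add: sqrt_coeff_def mult.commute)
  also have "\<dots> = (real m - 1/2) gchoose m"
    using gbinomial_negated_upper[of "-1/2::real" m] by (simp add: algebra_simps flip: power_add mult.assoc)
  also have "\<dots> \<ge> 0"
    by (auto simp: gbinomial_prod_rev intro!: divide_nonneg_pos prod_nonneg)
  finally show ?thesis .
qed

lemma summable_abs_sqrt_coeff: "summable (\<lambda>n. \<bar>sqrt_coeff n\<bar>)"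
proof (rule bounded_imp_summable[where B = 2])
  fix n
  have "(\<Sum>k\<le>n. \<bar>sqrt_coeff k\<bar>) = 2 - (\<Sum>k\<le>n. sqrt_coeff k)"
    by (induction n) (simp_all add: abs_of_nonpos[OF sqrt_coeff_Suc_nonpos])
  then show "(\<Sum>k\<le>n. \<bar>sqrt_coeff k\<bar>) \<le> 2"
    using sqrt_coeff_partial_sum_nonneg[of n] by simp
qed simp

lemmas summable_sqrt_coeff = summable_rabs_cancel[OF summable_abs_sqrt_coeff]

text \<open>
  The square of the sum is the sum of the convolution, \<open>1 - 1 = 0\<close>.
\<close>

lemma suminf_sqrt_coeff: "(\<Sum>n. sqrt_coeff n) = 0"
proof -
  have "(\<lambda>k. \<Sum>i\<le>k. sqrt_coeff i * sqrt_coeff (k - i)) sums ((\<Sum>n. sqrt_coeff n) * (\<Sum>n. sqrt_coeff n))"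
    by (rule Cauchy_product_sums) (simp_all add: summable_abs_sqrt_coeff)
  moreover have "(\<lambda>k::nat. if k = 0 then 1 else if k = 1 then -1 else (0::real)) sums
      (\<Sum>k\<in>{0,1::nat}. if k = 0 then 1 else if k = 1 then -1 else (0::real))"
    by (rule sums_finite) auto
  ultimately show ?thesis
    by (simp add: sqrt_coeff_convolution sums_iff)
qed

lemma suminf_abs_sqrt_coeff_Suc: "(\<Sum>n. \<bar>sqrt_coeff (Suc n)\<bar>) = 1"
proof -
  have "(\<Sum>n. \<bar>sqrt_coeff (Suc n)\<bar>) = (\<Sum>n. - sqrt_coeff (Suc n))"
    by (simp add: abs_of_nonpos[OF sqrt_coeff_Suc_nonpos])
  also have "\<dots> = 1"
    using suminf_split_head[OF summable_sqrt_coeff]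
    by (subst suminf_minus) (auto simp: suminf_sqrt_coeff summable_Suc_iff summable_sqrt_coeff)
  finally show ?thesis .
qed

lemma suminf_abs_sqrt_coeff: "(\<Sum>n. \<bar>sqrt_coeff n\<bar>) = 2"
  using suminf_split_head[OF summable_abs_sqrt_coeff] by (simp add: suminf_abs_sqrt_coeff_Suc)

section \<open>Self-adjoint contractive multipliers\<close>

text \<open>
  Self-adjoint contractions in the multiplier algebra, seen as operators on \<open>A\<close>. Besides left
  multiplication by self-adjoint elements of the unit ball these include the operators
  \<open>\<lambda>x. x - t * x\<close>, which stand for the elements \<open>1 - t\<close> of the unitization.
\<close>

definition sa_contraction :: "('a::cstar_algebra \<Rightarrow> 'a) \<Rightarrow> bool" where
  "sa_contraction V \<longleftrightarrow> bounded_linear V \<and> (\<forall>x. norm (V x) \<le> norm x) \<and>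
     (\<forall>x y. star (V x) * y = star x * V y)"

text \<open>
  The operator \<open>\<surd>(1 - W)\<close>.
\<close>

definition mult_sqrt :: "('a::cstar_algebra \<Rightarrow> 'a) \<Rightarrow> 'a \<Rightarrow> 'a" where
  "mult_sqrt W x = (\<Sum>n. sqrt_coeff n *\<^sub>R (W ^^ n) x)"

lemma sa_contractionI:
  assumes "bounded_linear V" "\<And>x. norm (V x) \<le> norm x" "\<And>x y. star (V x) * y = star x * V y"
  shows "sa_contraction V"
  using assms by (simp add: sa_contraction_def)

lemma sa_contractionD:
  assumes "sa_contraction V"
  shows "bounded_linear V" "norm (V x) \<le> norm x" "star (V x) * y = star x * V y"
  using assms by (simp_all add: sa_contraction_def)

lemma sa_contraction_left_mult:
  fixes a :: "'a::cstar_algebra"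
  assumes "star a = a" "norm a \<le> 1"
  shows "sa_contraction (\<lambda>x. a * x)"
proof (rule sa_contractionI)
  show "norm (a * x) \<le> norm x" for x
    using norm_mult_ineq[of a x] mult_right_mono[OF assms(2), of "norm x"] by simp
qed (simp_all add: bounded_linear_mult_right star_mult assms mult.assoc)

lemma sa_contraction_id: "sa_contraction (\<lambda>x. x)"
  by (rule sa_contractionI) auto

lemma sa_contraction_comp:
  assumes "sa_contraction V" "sa_contraction W" "\<And>x. V (W x) = W (V x)"
  shows "sa_contraction (\<lambda>x. V (W x))"
proof (rule sa_contractionI)
  show "bounded_linear (\<lambda>x. V (W x))"
    using bounded_linear_compose[OF sa_contractionD(1)[OF assms(1)] sa_contractionD(1)[OF assms(2)]] .
  show "norm (V (W x)) \<le> norm x" for x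
    using sa_contractionD(2)[OF assms(1), of "W x"] sa_contractionD(2)[OF assms(2), of x] by simp
  show "star (V (W x)) * y = star x * V (W y)" for x y
    using sa_contractionD(3)[OF assms(1)] sa_contractionD(3)[OF assms(2)] by (simp add: assms(3))
qed

lemma sa_contraction_funpow:
  assumes "sa_contraction W"
  shows "sa_contraction (W ^^ n)"
proof (induction n)
  case 0
  then show ?case using sa_contraction_id by (simp add: id_def)
next
  case (Suc n)
  have "sa_contraction (\<lambda>x. W ((W ^^ n) x))"
    by (rule sa_contraction_comp[OF assms Suc]) (metis funpow_swap1)
  then show ?case by (simp add: o_def)
qed

lemma funpow_commute:
  assumes "\<And>x. T (W x) = W (T x)"
  shows "T ((W ^^ n) x) = (W ^^ n) (T x)"
  by (induction n) (simp_all add: assms)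

context
  fixes W :: "'a::cstar_algebra \<Rightarrow> 'a"
  assumes W: "sa_contraction W"
begin

lemma mult_sqrt_summable_norm: "summable (\<lambda>n. norm (sqrt_coeff n *\<^sub>R (W ^^ n) x))"
proof (rule summable_comparison_test')
  show "summable (\<lambda>n. \<bar>sqrt_coeff n\<bar> * norm x)"
    by (rule summable_mult2[OF summable_abs_sqrt_coeff])
  show "norm (norm (sqrt_coeff n *\<^sub>R (W ^^ n) x)) \<le> \<bar>sqrt_coeff n\<bar> * norm x" for n
    using sa_contractionD(2)[OF sa_contraction_funpow[OF W]] by (simp add: mult_left_mono)
qed

lemmas mult_sqrt_summable = summable_norm_cancel[OF mult_sqrt_summable_norm]

text \<open>
  The operator \<open>1 - \<surd>(1 - W)\<close> is a convex combination of the powers \<open>W, W\<^sup>2, \<dots>\<close>, because the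
  coefficients \<open>- sqrt_coeff (Suc n)\<close> are nonnegative with sum \<open>1\<close>.
\<close>

lemma norm_id_minus_mult_sqrt: "norm (x - mult_sqrt W x) \<le> norm x"
proof -
  have "mult_sqrt W x = x + (\<Sum>n. sqrt_coeff (Suc n) *\<^sub>R (W ^^ Suc n) x)"
    unfolding mult_sqrt_def using suminf_split_head[OF mult_sqrt_summable[of x]] by simp
  then have "norm (x - mult_sqrt W x) = norm (\<Sum>n. sqrt_coeff (Suc n) *\<^sub>R (W ^^ Suc n) x)"
    by simp
  also have "\<dots> \<le> (\<Sum>n. \<bar>sqrt_coeff (Suc n)\<bar> * norm x)"
  proof (rule norm_suminf_le)
    show "norm (sqrt_coeff (Suc n) *\<^sub>R (W ^^ Suc n) x) \<le> \<bar>sqrt_coeff (Suc n)\<bar> * norm x" for n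
      unfolding norm_scaleR
      by (rule mult_left_mono[OF sa_contractionD(2)[OF sa_contraction_funpow[OF W]]]) simp
    show "summable (\<lambda>n. \<bar>sqrt_coeff (Suc n)\<bar> * norm x)"
      using summable_ignore_initial_segment[OF summable_abs_sqrt_coeff, of 1]
      by (intro summable_mult2) simp
  qed
  also have "\<dots> = norm x"
    using summable_ignore_initial_segment[OF summable_abs_sqrt_coeff, of 1]
    by (subst suminf_mult2[symmetric]) (simp_all add: suminf_abs_sqrt_coeff_Suc)
  finally show ?thesis .
qed

lemma mult_sqrt_commute:
  assumes "bounded_linear T" "\<And>x. T (W x) = W (T x)"
  shows "T (mult_sqrt W x) = mult_sqrt W (T x)"
  unfolding mult_sqrt_def
  using bounded_linear.suminf[OF assms(1) mult_sqrt_summable[of x]] funpow_commute[of T W, OF assms(2)]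
  by (simp add: linear_scale[OF bounded_linear.linear[OF assms(1)]])

lemma mult_sqrt_symmetric: "star (mult_sqrt W x) * y = star x * mult_sqrt W y"
proof -
  have "star (mult_sqrt W x) * y = (\<Sum>n. star (sqrt_coeff n *\<^sub>R (W ^^ n) x) * y)"
    unfolding mult_sqrt_def
    by (rule bounded_linear.suminf[OF bounded_linear_compose[OF bounded_linear_mult_left
            bounded_linear_star] mult_sqrt_summable])
  also have "\<dots> = (\<Sum>n. star x * (sqrt_coeff n *\<^sub>R (W ^^ n) y))"
    using sa_contractionD(3)[OF sa_contraction_funpow[OF W]] by (simp add: star_scaleR)
  also have "\<dots> = star x * mult_sqrt W y"
    unfolding mult_sqrt_def
    by (rule bounded_linear.suminf[OF bounded_linear_mult_right mult_sqrt_summable, symmetric])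
  finally show ?thesis .
qed

lemma mult_sqrt_square: "mult_sqrt W (mult_sqrt W x) = x - W x"
proof -
  define S where "S N x = (\<Sum>n<N. sqrt_coeff n *\<^sub>R (W ^^ n) x)" for N x
  let ?c = sqrt_coeff
  have lim: "(\<lambda>N. S N y) \<longlonglongrightarrow> mult_sqrt W y" for y
    unfolding S_def mult_sqrt_def by (rule summable_LIMSEQ[OF mult_sqrt_summable])
  have L: "linear (W ^^ n)" for n
    by (rule bounded_linear.linear[OF sa_contractionD(1)[OF sa_contraction_funpow[OF W]]])
  have contr: "norm ((W ^^ n) y) \<le> norm y" for n y
    by (rule sa_contractionD(2)[OF sa_contraction_funpow[OF W]])
  have Sdiff: "S N y - S N z = S N (y - z)" for N y z
    unfolding S_def by (simp add: linear_diff[OF L] scaleR_right_diff_distrib sum_subtractf)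
  have Sbd: "norm (S N y) \<le> 2 * norm y" for N y
  proof -
    have "norm (S N y) \<le> (\<Sum>n<N. \<bar>?c n\<bar> * norm y)"
      unfolding S_def by (rule sum_norm_le) (simp add: contr mult_left_mono)
    also have "\<dots> \<le> 2 * norm y"
      unfolding sum_distrib_right[symmetric] suminf_abs_sqrt_coeff[symmetric]
      by (intro mult_right_mono sum_le_suminf summable_abs_sqrt_coeff) auto
    finally show ?thesis .
  qed
  have "(\<lambda>N. S N (S N x) - S N (mult_sqrt W x)) \<longlonglongrightarrow> 0"
  proof (rule Lim_null_comparison)
    show "\<forall>\<^sub>F N in sequentially. norm (S N (S N x) - S N (mult_sqrt W x))
        \<le> 2 * norm (S N x - mult_sqrt W x)"
      by (simp add: Sdiff Sbd)
    show "(\<lambda>N. 2 * norm (S N x - mult_sqrt W x)) \<longlonglongrightarrow> 0"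
      using tendsto_mult_right_zero[OF tendsto_norm_zero[OF LIM_zero[OF lim[of x]]]] by simp
  qed
  then have SS: "(\<lambda>N. S N (S N x)) \<longlonglongrightarrow> mult_sqrt W (mult_sqrt W x)"
    using tendsto_add[OF _ lim[of "mult_sqrt W x"]] by fastforce
  \<comment> \<open>The partial sums of the Cauchy product run over a triangle, the products of partial
    sums over a square; the difference is dominated by the same difference for \<open>\<bar>c\<^sub>n\<bar>\<close>.\<close>
  define g where "g i j = (?c i * ?c j) *\<^sub>R (W ^^ (i + j)) x" for i j
  define T where "T N = {(i, j). i + j < (N::nat)}" for N
  have TN: "T N \<subseteq> {..<N} \<times> {..<N}" for N
    by (auto simp: T_def)
  have SSg: "S N (S N x) = (\<Sum>(i, j)\<in>{..<N} \<times> {..<N}. g i j)" for N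
    unfolding S_def g_def
    by (simp add: linear_sum[OF L] linear_scale[OF L] scaleR_sum_right sum.cartesian_product
        funpow_add o_def)
  have Tg: "(\<Sum>(i, j)\<in>T N. g i j) = x - W x" if "N \<ge> 2" for N
  proof -
    have "(\<Sum>(i, j)\<in>T N. g i j) = (\<Sum>k<N. \<Sum>i\<le>k. g i (k - i))"
      unfolding T_def by (rule sum.triangle_reindex)
    also have "\<dots> = (\<Sum>k<N. (\<Sum>i\<le>k. ?c i * ?c (k - i)) *\<^sub>R (W ^^ k) x)"
      by (simp add: g_def scaleR_sum_left)
    also have "\<dots> = (\<Sum>k\<in>{0,1}. (\<Sum>i\<le>k. ?c i * ?c (k - i)) *\<^sub>R (W ^^ k) x)"
      using that by (intro sum.mono_neutral_right) (auto simp: sqrt_coeff_convolution)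
    also have "\<dots> = x - W x"
      by (simp add: sqrt_coeff_convolution del: sum.atMost_Suc)
    finally show ?thesis .
  qed
  define D where "D N = (\<Sum>n<N. \<bar>?c n\<bar>) * (\<Sum>n<N. \<bar>?c n\<bar>) - (\<Sum>k<N. \<Sum>i\<le>k. \<bar>?c i\<bar> * \<bar>?c (k - i)\<bar>)" for N
  have "D \<longlonglongrightarrow> 0"
  proof -
    have "D \<longlonglongrightarrow> (\<Sum>n. \<bar>?c n\<bar>) * (\<Sum>n. \<bar>?c n\<bar>) - (\<Sum>n. \<bar>?c n\<bar>) * (\<Sum>n. \<bar>?c n\<bar>)"
      unfolding D_def
      by (intro tendsto_intros summable_LIMSEQ summable_abs_sqrt_coeff
          Cauchy_product_sums[unfolded sums_def]) (simp_all add: summable_abs_sqrt_coeff)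
    then show ?thesis by simp
  qed
  have "(\<lambda>N. S N (S N x) - (x - W x)) \<longlonglongrightarrow> 0"
  proof (rule Lim_null_comparison)
    show "\<forall>\<^sub>F N in sequentially. norm (S N (S N x) - (x - W x)) \<le> D N * norm x"
      unfolding eventually_sequentially
    proof (intro exI allI impI)
      fix N :: nat assume N: "2 \<le> N"
      let ?R = "{..<N} \<times> {..<N} - T N"
      have "S N (S N x) - (x - W x) = (\<Sum>(i, j)\<in>?R. g i j)"
        using sum_diff[of "{..<N} \<times> {..<N}" "T N" "\<lambda>(i, j). g i j"] TN[of N] Tg[OF N] SSg[of N]
        by simp
      also have "norm \<dots> \<le> (\<Sum>(i, j)\<in>?R. \<bar>?c i\<bar> * \<bar>?c j\<bar> * norm x)"
        by (rule sum_norm_le) (auto simp: g_def abs_mult intro!: mult_left_mono contr)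
      also have "\<dots> = (\<Sum>(i, j)\<in>?R. \<bar>?c i\<bar> * \<bar>?c j\<bar>) * norm x"
        by (simp add: sum_distrib_right case_prod_unfold)
      also have "(\<Sum>(i, j)\<in>?R. \<bar>?c i\<bar> * \<bar>?c j\<bar>) = D N"
        using sum_diff[of "{..<N} \<times> {..<N}" "T N" "\<lambda>(i, j). \<bar>?c i\<bar> * \<bar>?c j\<bar>"] TN[of N]
          sum.triangle_reindex[of "\<lambda>i j. \<bar>?c i\<bar> * \<bar>?c j\<bar>" N]
        by (simp add: D_def T_def sum_product sum.cartesian_product)
      finally show "norm (S N (S N x) - (x - W x)) \<le> D N * norm x" .
    qed
    show "(\<lambda>N. D N * norm x) \<longlonglongrightarrow> 0"
      by (rule tendsto_mult_left_zero[OF \<open>D \<longlonglongrightarrow> 0\<close>])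
  qed
  then have "(\<lambda>N. S N (S N x)) \<longlonglongrightarrow> x - W x"
    by (rule LIM_zero_cancel)
  then show ?thesis
    using LIMSEQ_unique SS by blast
qed

end

text \<open>
  With \<open>S = \<surd>(1 - V\<^sup>2)\<close> both \<open>V \<plusminus> \<i> S\<close> are isometric since \<open>V\<^sup>2 + S\<^sup>2 = 1\<close>. So \<open>S\<close> is half of a
  difference of isometries, hence a contraction, and therefore so is \<open>1 - V\<^sup>2 = S\<^sup>2\<close>.
\<close>

lemma norm_id_minus_square_le:
  assumes V: "sa_contraction V"
  shows "norm (x - V (V x)) \<le> norm x"
proof -
  define W where "W = (\<lambda>x. V (V x))"
  define S where "S = mult_sqrt W"
  have W: "sa_contraction W"
    unfolding W_def by (rule sa_contraction_comp[OF V V]) simp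
  have SS: "S (S y) = y - V (V y)" for y
    unfolding S_def mult_sqrt_square[OF W] by (simp add: W_def)
  have SV: "V (S y) = S (V y)" for y
    unfolding S_def by (rule mult_sqrt_commute[OF W sa_contractionD(1)[OF V]]) (simp add: W_def)
  have symS: "star (S y) * z = star y * S z" for y z
    unfolding S_def by (rule mult_sqrt_symmetric[OF W])
  note symV = sa_contractionD(3)[OF V]
  have iso: "norm (V y + c *\<^sub>C S y) = norm y" if c: "c = \<i> \<or> c = - \<i>" for c y
  proof -
    have "star (V y + c *\<^sub>C S y) * (V y + c *\<^sub>C S y)
        = star (V y) * V y + c *\<^sub>C (star (V y) * S y) + cnj c *\<^sub>C (star (S y) * V y)
          + (cnj c * c) *\<^sub>C (star (S y) * S y)"
      by (simp add: star_add star_scaleC distrib_left distrib_right mult_scaleC_left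
          mult_scaleC_right scaleC_add_right scaleC_scaleC mult.commute add_ac)
    also have "\<dots> = star y * y"
      using c by (auto simp: symS symV SV SS right_diff_distrib scaleC_minus_left)
    finally have "(norm (V y + c *\<^sub>C S y))\<^sup>2 = (norm y)\<^sup>2"
      by (metis cstar_identity)
    then show ?thesis
      by (simp add: power2_eq_iff_nonneg)
  qed
  have contr: "norm (S y) \<le> norm y" for y
  proof -
    have "2 *\<^sub>R (\<i> *\<^sub>C S y) = (V y + \<i> *\<^sub>C S y) - (V y + (- \<i>) *\<^sub>C S y)"
      by (simp add: scaleC_minus_left scaleR_2)
    then have "2 * norm (S y) \<le> norm (V y + \<i> *\<^sub>C S y) + norm (V y + (- \<i>) *\<^sub>C S y)"
      by (metis (no_types, lifting) norm_triangle_ineq4 norm_scaleR norm_scaleC abs_numeral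
          norm_ii mult_1)
    then show ?thesis
      by (simp add: iso)
  qed
  show ?thesis
    using contr[of "S x"] contr[of x] by (simp add: SS)
qed

section \<open>Square roots and positive parts\<close>

lemma commute_mult:
  fixes b x y :: "'a::semigroup_mult"
  assumes "x * b = b * x" "y * b = b * y"
  shows "(x * y) * b = b * (x * y)"
  by (metis assms mult.assoc)

text \<open>
  The self-adjoint \<open>t\<close> for which \<open>1 - t\<close> is a contraction; in spectral terms \<open>0 \<le> t \<le> 2\<close>. This
  form of positivity is evidently closed under convex combinations, and it is all that the binomial
  series needs.
\<close>

definition unit_pos :: "'a::cstar_algebra \<Rightarrow> bool" where
  "unit_pos t \<longleftrightarrow> star t = t \<and> (\<forall>x. norm (x - t * x) \<le> norm x)"

text \<open>
  The element \<open>1 - (1 - t)\<^sup>n\<close>, which lies in the algebra although \<open>1\<close> need not.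
\<close>

primrec comp_pow :: "'a::cstar_algebra \<Rightarrow> nat \<Rightarrow> 'a" where
  "comp_pow t 0 = 0"
| "comp_pow t (Suc n) = t + comp_pow t n - t * comp_pow t n"

context
  fixes t :: "'a::cstar_algebra"
  assumes t: "unit_pos t"
begin

lemma sa_contraction_unit_pos: "sa_contraction (\<lambda>x. x - t * x)"
proof (rule sa_contractionI)
  show "bounded_linear (\<lambda>x. x - t * x)"
    by (intro bounded_linear_sub bounded_linear_ident bounded_linear_mult_right)
qed (use t in \<open>simp_all add: unit_pos_def star_diff star_mult left_diff_distrib
      right_diff_distrib mult.assoc\<close>)

lemma funpow_eq_comp_pow: "((\<lambda>x. x - t * x) ^^ n) x = x - comp_pow t n * x"
  by (induction n) (simp_all add: right_diff_distrib left_diff_distrib distrib_right mult.assoc)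

lemma comp_pow_commute: "t * b = b * t \<Longrightarrow> comp_pow t n * b = b * comp_pow t n"
proof (induction n)
  case (Suc n)
  have "t * comp_pow t n * b = b * (t * comp_pow t n)"
    using Suc by (intro commute_mult) auto
  then show ?case
    using Suc by (simp add: distrib_left distrib_right left_diff_distrib right_diff_distrib)
qed simp

lemma star_comp_pow: "star (comp_pow t n) = comp_pow t n"
proof (induction n)
  case (Suc n)
  then show ?case
    using t comp_pow_commute[OF refl, of n]
    by (simp add: unit_pos_def star_add star_diff star_mult)
qed simp

text \<open>
  For self-adjoint \<open>e\<close> with \<open>1 - e\<close> contractive, \<open>\<parallel>e\<parallel>\<^sup>2 = \<parallel>e e\<parallel> \<le> \<parallel>e - e e\<parallel> + \<parallel>e\<parallel> \<le> 2 \<parallel>e\<parallel>\<close>.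
\<close>

lemma norm_comp_pow_le: "norm (comp_pow t n) \<le> 2"
proof -
  let ?e = "comp_pow t n"
  have "norm (?e - ?e * ?e) \<le> norm ?e"
    using sa_contractionD(2)[OF sa_contraction_funpow[OF sa_contraction_unit_pos], of n ?e]
    by (simp add: funpow_eq_comp_pow)
  then have "norm (?e * ?e) \<le> 2 * norm ?e"
    using norm_triangle_ineq3[of "?e * ?e" ?e] by (simp add: norm_minus_commute)
  then have "norm ?e * norm ?e \<le> 2 * norm ?e"
    using selfadj_norm_square[OF star_comp_pow] by (simp add: power2_eq_square)
  then show ?thesis
    by (cases "?e = 0") auto
qed

text \<open>
  As the coefficients have sum \<open>0\<close>, the series of \<open>\<surd>(1 - (1 - t))\<close> may be written in terms of
  \<open>1 - (1 - t)\<^sup>n\<close> instead of \<open>(1 - t)\<^sup>n\<close>, and then it converges in the algebra itself. The root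
  inherits commutation relations from \<open>t\<close>.
\<close>

lemma unit_pos_sqrt:
  obtains r where "unit_pos r" "r * r = t" "\<And>b. t * b = b * t \<Longrightarrow> r * b = b * r"
proof -
  let ?W = "\<lambda>x. x - t * x"
  define r where "r = (\<Sum>n. - sqrt_coeff n *\<^sub>R comp_pow t n)"
  note W = sa_contraction_unit_pos
  have sm: "summable (\<lambda>n. - sqrt_coeff n *\<^sub>R comp_pow t n)"
  proof (rule summable_comparison_test')
    show "summable (\<lambda>n. \<bar>sqrt_coeff n\<bar> * 2)"
      by (rule summable_mult2[OF summable_abs_sqrt_coeff])
    show "norm (- sqrt_coeff n *\<^sub>R comp_pow t n) \<le> \<bar>sqrt_coeff n\<bar> * 2" for n
      using norm_comp_pow_le[of n] by (simp add: mult_left_mono)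
  qed
  have rx: "r * x = mult_sqrt ?W x" for x
  proof -
    have "r * x = (\<Sum>n. (- sqrt_coeff n *\<^sub>R comp_pow t n) * x)"
      unfolding r_def by (rule bounded_linear.suminf[OF bounded_linear_mult_left sm])
    also have "\<dots> = (\<Sum>n. sqrt_coeff n *\<^sub>R (?W ^^ n) x - sqrt_coeff n *\<^sub>R x)"
      by (simp add: funpow_eq_comp_pow scaleR_right_diff_distrib)
    also have "\<dots> = mult_sqrt ?W x - (\<Sum>n. sqrt_coeff n) *\<^sub>R x"
      unfolding mult_sqrt_def suminf_scaleR_left[OF summable_sqrt_coeff]
      by (rule suminf_diff[symmetric]) (intro mult_sqrt_summable W summable_scaleR_left
          summable_sqrt_coeff)+
    finally show ?thesis
      by (simp add: suminf_sqrt_coeff)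
  qed
  have star_r: "star r = r"
    unfolding r_def
    by (subst bounded_linear.suminf[OF bounded_linear_star sm])
      (simp add: star_scaleR star_minus star_comp_pow)
  show thesis
  proof
    show "unit_pos r"
      using star_r norm_id_minus_mult_sqrt[OF W] by (simp add: unit_pos_def rx)
    have "r * (r * x) = t * x" for x
      unfolding rx mult_sqrt_square[OF W] by simp
    then have "(r * r - t) * x = 0" for x
      by (simp add: left_diff_distrib mult.assoc)
    then show "r * r = t"
      using eq_zero_if_right_mult[of "r * r - t"] by simp
    show "r * b = b * r" if "t * b = b * t" for b
      unfolding r_def bounded_linear.suminf[OF bounded_linear_mult_left sm]
        bounded_linear.suminf[OF bounded_linear_mult_right sm]
      by (simp add: comp_pow_commute[OF that])
  qed
qed

end

lemma unit_pos_square: "star a = a \<Longrightarrow> norm a \<le> 1 \<Longrightarrow> unit_pos (a * a)"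
  using norm_id_minus_square_le[OF sa_contraction_left_mult, of a]
  by (simp add: unit_pos_def star_mult mult.assoc)

text \<open>
  Here \<open>r\<close> is the absolute value of \<open>a\<close> and \<open>q\<close> its square root. Both are limits of polynomials in
  \<open>a * a\<close>.
\<close>

lemma selfadj_abs:
  fixes a :: "'a::cstar_algebra"
  assumes a: "star a = a"
  obtains r q where "star r = r" "star q = q" "q * q = r" "r * r = a * a"
    "\<And>b. a * a * b = b * (a * a) \<Longrightarrow> q * b = b * q"
proof -
  \<comment> \<open>Scaling by more than \<open>norm a\<close> brings \<open>a\<close> into the unit ball; the summand \<open>1\<close> covers \<open>a = 0\<close>.\<close>
  define K where "K = norm a + 1"
  have K: "K > 0"
    by (simp add: K_def add_nonneg_pos)
  define a' where "a' = (1/K) *\<^sub>R a"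
  have "unit_pos (a' * a')"
    using K by (intro unit_pos_square) (auto simp: a'_def star_scaleR a K_def)
  then obtain r' where r': "unit_pos r'" "r' * r' = a' * a'"
    and rc: "\<And>b. a' * a' * b = b * (a' * a') \<Longrightarrow> r' * b = b * r'"
    by (rule unit_pos_sqrt) blast
  from r'(1) obtain q' where q': "unit_pos q'" "q' * q' = r'"
    and qc: "\<And>b. r' * b = b * r' \<Longrightarrow> q' * b = b * q'"
    by (rule unit_pos_sqrt) blast
  show thesis
  proof
    show "star (K *\<^sub>R r') = K *\<^sub>R r'" "star (sqrt K *\<^sub>R q') = sqrt K *\<^sub>R q'"
      using r' q' by (simp_all add: unit_pos_def star_scaleR)
    show "sqrt K *\<^sub>R q' * sqrt K *\<^sub>R q' = K *\<^sub>R r'"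
      using K by (simp add: q')
    show "K *\<^sub>R r' * K *\<^sub>R r' = a * a"
      using K by (simp add: r' a'_def)
    show "sqrt K *\<^sub>R q' * b = b * sqrt K *\<^sub>R q'" if "a * a * b = b * (a * a)" for b
      using qc[OF rc, of b] that by (simp add: a'_def)
  qed
qed

text \<open>
  If \<open>r\<close> and \<open>s\<close> commuted, \<open>r + \<i> s\<close> would be normal with \<open>(r + \<i> s)\<^sup>* (r + \<i> s) = r\<^sup>2 + s\<^sup>2 = 0\<close>.
  Replacing \<open>s\<close> by the absolute value \<open>w\<close> of \<open>s\<close> achieves this, since \<open>r\<close> commutes with
  \<open>s\<^sup>2 = - r\<^sup>2\<close>.
\<close>

lemma squares_sum_zero:
  fixes r s :: "'a::cstar_algebra"
  assumes r: "star r = r" and s: "star s = s" and eq: "r * r = - (s * s)"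
  shows "r = 0"
proof -
  obtain w q where w: "star w = w" "q * q = w" "w * w = s * s"
    and wc: "\<And>b. s * s * b = b * (s * s) \<Longrightarrow> q * b = b * q"
    using selfadj_abs[OF s] by metis
  have ss: "s * s = - (r * r)"
    using eq by simp
  have "q * r = r * q"
    by (rule wc) (simp add: ss mult.assoc)
  then have wr: "w * r = r * w"
    unfolding w(2)[symmetric] by (intro commute_mult)
  have "star (r + \<i> *\<^sub>C w) * (r + \<i> *\<^sub>C w) = 0"
    by (simp add: star_add star_scaleC r w eq wr distrib_left distrib_right left_diff_distrib
        scaleC_diff_right mult_scaleC_left
        mult_scaleC_right scaleC_scaleC scaleC_minus_left)
  then have u: "r + \<i> *\<^sub>C w = 0"
    by (simp add: star_mult_self_eq_0)
  then have "star (r + \<i> *\<^sub>C w) = 0"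
    by simp
  then have "r - \<i> *\<^sub>C w = 0"
    by (simp add: star_add star_scaleC r w scaleC_minus_left)
  with u have "2 *\<^sub>R r = 0"
    by (simp add: scaleR_2)
  then show ?thesis by simp
qed

text \<open>
  The negative part \<open>n\<close> of \<open>a\<close> satisfies \<open>a n = - n\<^sup>2\<close>, so that \<open>n a\<^sup>3 n = - n\<^sup>5\<close>. Both
  \<open>n a\<^sup>3 n\<close> and \<open>n\<^sup>5\<close> are squares of self-adjoint elements, hence both vanish and \<open>n = 0\<close>.
  So \<open>a\<close> is its own absolute value, which is a square.
\<close>

lemma square_if_cube_square:
  fixes a s :: "'a::cstar_algebra"
  assumes a: "star a = a" and s: "star s = s" and cube: "a * a * a = s * s"
  obtains q where "star q = q" "q * q = a"
proof -
  obtain r q where r: "star r = r" and q: "star q = q" "q * q = r" and rr: "r * r = a * a"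
    and qc: "\<And>b. a * a * b = b * (a * a) \<Longrightarrow> q * b = b * q"
    using selfadj_abs[OF a] by metis
  obtain w v where w: "star w = w" "v * v = w" and ww: "w * w = s * s"
    and vc: "\<And>b. s * s * b = b * (s * s) \<Longrightarrow> v * b = b * v"
    using selfadj_abs[OF s] by metis
  have qa: "q * a = a * q"
    by (rule qc) (simp add: mult.assoc)
  have ra: "r * a = a * r"
    unfolding q(2)[symmetric] by (intro commute_mult qa)
  have qr: "q * r = r * q"
    unfolding q(2)[symmetric] by (simp add: mult.assoc)
  define n where "n = (1/2) *\<^sub>R (r - a)"
  have rn: "r = a + (n + n)"
    by (simp add: n_def flip: scaleR_2)
  have na: "n * a = a * n"
    by (simp add: n_def ra left_diff_distrib right_diff_distrib)
  have qn: "q * n = n * q"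
    by (simp add: n_def qa qr left_diff_distrib right_diff_distrib)
  have n: "star n = n"
    by (simp add: n_def star_scaleR star_diff r a)
  have "2 *\<^sub>R (2 *\<^sub>R (a * n + n * n)) = 0"
    using rr unfolding rn scaleR_2 by (simp add: distrib_left distrib_right na add_ac)
  then have an: "a * n = - (n * n)"
    by (simp add: eq_neg_iff_add_eq_0)
  have rn2: "r * n = n * n"
    by (simp add: rn distrib_right an)
  have vn: "v * n = n * v"
    unfolding cube[symmetric] by (intro vc[unfolded cube[symmetric]] commute_mult na[symmetric])
  have wn: "w * n = n * w"
    unfolding w(2)[symmetric] by (intro commute_mult vn)
  have qnn: "q * n * n = n * n * q"
    by (simp only: qn mult.assoc)
  have n5: "(q * n * n) * (q * n * n) = n * n * n * n * n"
  proof -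
    have "(q * n * n) * (q * n * n) = (n * n * q) * (q * n * n)"
      by (simp only: qnn)
    also have "\<dots> = n * n * ((q * q) * n) * n"
      by (simp add: mult.assoc)
    finally show ?thesis
      by (simp add: q(2) rn2 mult.assoc)
  qed
  have "(w * n) * (w * n) = w * (n * w) * n"
    by (simp add: mult.assoc)
  also have "\<dots> = (w * w) * n * n"
    by (simp add: wn[symmetric] mult.assoc)
  also have "\<dots> = a * (a * (a * n)) * n"
    by (simp add: ww cube[symmetric] mult.assoc)
  also have "\<dots> = - (n * n * n * n * n)"
    by (simp add: an flip: mult.assoc)
  finally have wn5: "(w * n) * (w * n) = - (n * n * n * n * n)" .
  have "w * n = 0"
  proof (rule squares_sum_zero)
    show "star (w * n) = w * n" by (simp add: star_mult w n wn)
    show "star (q * n * n) = q * n * n" by (simp add: star_mult q n qnn flip: mult.assoc)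
    show "w * n * (w * n) = - (q * n * n * (q * n * n))" by (simp add: n5 wn5)
  qed
  with wn5 have "n * n * n * n * n = 0"
    by simp
  then have "n * n * (n * n) * (n * n * (n * n)) = 0"
    by (simp flip: mult.assoc)
  then have "n = 0"
    using selfadj_nilpotent[of "n * n"] selfadj_nilpotent[of n] n by (simp add: star_mult)
  then have "q * q = a"
    using rn q(2) by simp
  with q(1) show thesis by (rule that)
qed

text \<open>
  The two squares are the positive and the negative part of \<open>a\<close>. For either part \<open>p\<close>, with \<open>r\<close> the
  absolute value of \<open>a\<close> and \<open>q\<close> its root, \<open>r p = p\<^sup>2\<close> gives \<open>p\<^sup>3 = p r p = (q p)\<^sup>2\<close>, and a self-adjoint element whose cube is a
  square is a square.
\<close>

lemma selfadj_diff_squares: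
  fixes a :: "'a::cstar_algebra"
  assumes a: "star a = a"
  obtains s u where "star s = s" "star u = u" "a = s * s - u * u"
    "norm (s * s) \<le> norm a" "norm (u * u) \<le> norm a"
proof -
  obtain r q where r: "star r = r" and q: "star q = q" "q * q = r" and rr: "r * r = a * a"
    and qc: "\<And>b. a * a * b = b * (a * a) \<Longrightarrow> q * b = b * q"
    using selfadj_abs[OF a] by metis
  have "(norm r)\<^sup>2 = (norm a)\<^sup>2"
    by (metis a r rr selfadj_norm_square)
  then have nr: "norm r = norm a"
    by (simp add: power2_eq_iff_nonneg)
  have part: "\<exists>s. star s = s \<and> s * s = (1/2) *\<^sub>R (r + b) \<and> norm (s * s) \<le> norm a"
    if b: "star b = b" "b * b = a * a" "norm b = norm a" for b
  proof -
    define p where "p = (1/2) *\<^sub>R (r + b)"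
    have p: "star p = p"
      by (simp add: p_def star_scaleR star_add r b)
    have qb: "q * b = b * q"
      by (rule qc) (simp add: b(2)[symmetric] mult.assoc)
    have qp: "q * p = p * q"
      unfolding p_def q(2)[symmetric]
      by (simp add: qb distrib_left distrib_right mult.assoc)
    have rb: "r * b = b * r"
      unfolding q(2)[symmetric] by (intro commute_mult qb)
    have "p + p = r + b"
      by (simp add: p_def flip: scaleR_2)
    then have "(p + p) * (p + p) = r * (p + p) + r * (p + p)"
      by (simp add: distrib_left distrib_right rb rr b(2) add_ac)
    then have "2 *\<^sub>R (2 *\<^sub>R (r * p)) = 2 *\<^sub>R (2 *\<^sub>R (p * p))"
      by (simp add: scaleR_2 distrib_left distrib_right)
    then have rp: "r * p = p * p"
      by simp
    have "(q * p) * (q * p) = (p * q) * (q * p)"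
      by (simp only: qp)
    also have "\<dots> = p * (r * p)"
      by (simp add: q(2)[symmetric] mult.assoc)
    finally have "p * p * p = (q * p) * (q * p)"
      by (simp add: rp mult.assoc)
    moreover have "star (q * p) = q * p"
      by (simp add: star_mult p q qp)
    ultimately obtain s where s: "star s = s" "s * s = p"
      using square_if_cube_square[OF p] by metis
    have "norm p \<le> norm a"
      using norm_triangle_ineq[of r b] by (simp add: p_def nr b(3))
    with s show ?thesis
      by (auto simp: p_def)
  qed
  obtain s where s: "star s = s" "s * s = (1/2) *\<^sub>R (r + a)" "norm (s * s) \<le> norm a"
    using part[of a] a by auto
  obtain u where u: "star u = u" "u * u = (1/2) *\<^sub>R (r + - a)" "norm (u * u) \<le> norm a"
    using part[of "- a"] a by (auto simp: star_minus)
  have "a = s * s - u * u"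
    unfolding s(2) u(2) scaleR_right_diff_distrib[symmetric] by (simp flip: scaleR_2)
  with s u show thesis
    using that by blast
qed

section \<open>Positive functionals are bounded\<close>

lemma unit_pos_half_series:
  fixes s :: "nat \<Rightarrow> 'a::cstar_algebra"
  assumes s: "\<And>m. star (s m) = s m" "\<And>m. norm (s m) \<le> 1"
  shows "summable (\<lambda>m. (1/2) ^ Suc m *\<^sub>R (s m * s m))"
    and "unit_pos (\<Sum>m. (1/2) ^ Suc m *\<^sub>R (s m * s m))"
proof -
  have half: "summable (\<lambda>m. (1/2::real) ^ Suc m)" "(\<Sum>m. (1/2::real) ^ Suc m) = 1"
    using power_half_series by (simp_all add: sums_iff)
  have ns: "norm (s m * s m) \<le> 1" for m
    using s by (simp add: selfadj_norm_square power_le_one)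
  show sm: "summable (\<lambda>m. (1/2) ^ Suc m *\<^sub>R (s m * s m))"
  proof (rule summable_comparison_test'[OF half(1)])
    show "norm ((1/2) ^ Suc m *\<^sub>R (s m * s m)) \<le> (1/2) ^ Suc m" for m
      using ns[of m] by (simp add: mult_left_le)
  qed
  let ?t = "\<Sum>m. (1/2) ^ Suc m *\<^sub>R (s m * s m)"
  show "unit_pos ?t"
    unfolding unit_pos_def
  proof (intro conjI allI)
    show "star ?t = ?t"
      by (subst bounded_linear.suminf[OF bounded_linear_star sm])
        (simp add: star_scaleR star_mult s)
    fix x
    have smx: "summable (\<lambda>m. (1/2) ^ Suc m *\<^sub>R (s m * s m) * x)"
      by (rule bounded_linear.summable[OF bounded_linear_mult_left sm])
    have "x - ?t * x = (\<Sum>m. (1/2) ^ Suc m) *\<^sub>R x - (\<Sum>m. (1/2) ^ Suc m *\<^sub>R (s m * s m) * x)"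
      unfolding half(2) bounded_linear.suminf[OF bounded_linear_mult_left sm] by simp
    also have "\<dots> = (\<Sum>m. (1/2) ^ Suc m *\<^sub>R x - (1/2) ^ Suc m *\<^sub>R (s m * s m) * x)"
      unfolding suminf_scaleR_left[OF half(1)]
      by (rule suminf_diff[OF summable_scaleR_left[OF half(1)] smx])
    also have "\<dots> = (\<Sum>m. (1/2) ^ Suc m *\<^sub>R (x - s m * s m * x))"
      by (simp add: scaleR_right_diff_distrib)
    also have "norm \<dots> \<le> (\<Sum>m. (1/2) ^ Suc m * norm x)"
    proof (rule norm_suminf_le)
      show "norm ((1/2) ^ Suc m *\<^sub>R (x - s m * s m * x)) \<le> (1/2) ^ Suc m * norm x" for m
        using unit_pos_square[OF s] by (simp add: unit_pos_def mult_left_mono)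
    qed (rule summable_mult2[OF half(1)])
    also have "\<dots> = norm x"
      by (simp add: suminf_mult2[OF half(1), symmetric] half(2) del: power_Suc)
    finally show "norm (x - ?t * x) \<le> norm x" .
  qed
qed

text \<open>
  If \<open>f\<close> were unbounded on squares, there would be squares \<open>y\<^sub>n\<^sup>2\<close> in the unit ball with
  \<open>f (y\<^sub>n\<^sup>2) \<ge> 4\<^sup>n\<close>. Every tail of the series of \<open>2\<^sup>-\<^sup>n y\<^sub>n\<^sup>2\<close> is a square up to a factor, so \<open>f\<close> is
  nonnegative on the tails, and the value of \<open>f\<close> at the whole sum would exceed every bound.
\<close>

lemma positive_functional_bounded:
  fixes f :: "'a::cstar_algebra \<Rightarrow> real"
  assumes f: "linear f" and pos: "\<And>s. star s = s \<Longrightarrow> 0 \<le> f (s * s)"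
  obtains C where "C \<ge> 0" "\<And>s. star s = s \<Longrightarrow> f (s * s) \<le> C * (norm s)\<^sup>2"
proof (rule ccontr)
  assume "\<not> thesis"
  then have "\<exists>s. star s = s \<and> f (s * s) > C * (norm s)\<^sup>2" if "C \<ge> 0" for C
    using that \<open>\<And>C. \<lbrakk>0 \<le> C; \<And>s. star s = s \<Longrightarrow> f (s * s) \<le> C * (norm s)\<^sup>2\<rbrakk> \<Longrightarrow> thesis\<close>
    by (meson not_le)
  then have "\<exists>s. star s = s \<and> f (s * s) > 4 ^ n * (norm s)\<^sup>2" for n :: nat
    by simp
  then obtain s where s: "\<And>n. star (s n) = s n" "\<And>n. f (s n * s n) > 4 ^ n * (norm (s n))\<^sup>2"
    by metis
  define y where "y n = (1 / norm (s n)) *\<^sub>R s n" for n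
  have s0: "s n \<noteq> 0" for n
    using s(2)[of n] linear_0[OF f] by auto
  have y: "star (y n) = y n" "norm (y n) \<le> 1" for n
    using s0[of n] s(1) by (simp_all add: y_def star_scaleR)
  have fy: "f (y n * y n) \<ge> 4 ^ n" for n
    using s(2)[of n] s0[of n]
    by (simp add: y_def linear_scale[OF f] field_simps power2_eq_square)
  define T where "T N = (\<Sum>m. (1/2) ^ Suc m *\<^sub>R (y (N + m) * y (N + m)))" for N
  note U = unit_pos_half_series[of "\<lambda>m. y (N + m)" for N, OF y]
  have fT: "f (T N) \<ge> 0" for N
    using unit_pos_sqrt[OF U(2)[of N]] pos unfolding T_def unit_pos_def by metis
  have step: "T N = (1/2) *\<^sub>R (y N * y N) + (1/2) *\<^sub>R T (Suc N)" for N
  proof -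
    have "T N = (1/2) *\<^sub>R (y N * y N)
        + (\<Sum>m. (1/2) *\<^sub>R ((1/2) ^ Suc m *\<^sub>R (y (Suc N + m) * y (Suc N + m))))"
      unfolding T_def using suminf_split_head[OF U(1)[of N]] by simp
    then show ?thesis
      unfolding T_def using suminf_scaleR_right[OF U(1)[of "Suc N"], of "1/2"] by simp
  qed
  have fstep: "f (T N) = f (y N * y N) / 2 + f (T (Suc N)) / 2" for N
    by (subst step) (simp add: linear_add[OF f] linear_scale[OF f])
  have "f (T 0) \<ge> (1/2) ^ N * f (T N)" for N
  proof (induction N)
    case (Suc N)
    have "f (T (Suc N)) \<le> 2 * f (T N)"
      using pos[OF y(1), of N] fstep[of N] by simp
    then have "(1/2) ^ Suc N * f (T (Suc N)) \<le> (1/2) ^ Suc N * (2 * f (T N))"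
      by (intro mult_left_mono) auto
    also have "\<dots> = (1/2) ^ N * f (T N)" by simp
    finally show ?case using Suc by (rule order.trans)
  qed simp
  moreover have "(1/2) ^ N * f (T N) \<ge> 2 ^ N / 2" for N
  proof -
    have "f (T N) \<ge> 4 ^ N / 2"
      using fstep[of N] fT[of "Suc N"] fy[of N] by simp
    then have "(1/2) ^ N * f (T N) \<ge> (1/2) ^ N * (4 ^ N / 2)"
      by (simp add: mult_left_mono)
    then show ?thesis
      by (simp add: flip: power_mult_distrib)
  qed
  ultimately have "2 ^ N \<le> 2 * f (T 0)" for N
    by (smt (verit) field_sum_of_halves)
  moreover obtain N where "2 * f (T 0) < 2 ^ N"
    using real_arch_pow[of 2 "2 * f (T 0)"] by auto
  ultimately show False
    by (meson not_le)
qed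

section \<open>Approximate units\<close>

text \<open>
  With \<open>t\<close> a multiple of \<open>a\<^sup>2\<close> and \<open>m\<close> the Cesaro means of \<open>1 - (1 - t)\<^sup>n\<close>, the contractions \<open>1 - m\<close>
  kill \<open>t\<close>, hence \<open>a\<close>, in the limit. The elements \<open>e = 1 - (1 - m)\<^sup>2\<close> are used in place of \<open>m\<close>, because
  for a square \<open>(1 - m)\<^sup>2\<close> of a self-adjoint contraction both \<open>(1 - m)\<^sup>2\<close> and \<open>1 - (1 - m)\<^sup>2\<close> are
  contractions.
\<close>

lemma selfadj_approx_unit:
  fixes a :: "'a::cstar_algebra"
  assumes a: "star a = a"
  obtains e :: "nat \<Rightarrow> 'a" where "\<And>n. star (e n) = e n" "\<And>n. norm (e n) \<le> 1"
    "\<And>n. \<exists>f. e n = a * f" "(\<lambda>n. a - e n * a) \<longlonglongrightarrow> 0" "\<And>n. e n * a = a * e n"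
    "\<And>n x. norm (x - e n * x) \<le> norm x"
proof -
  \<comment> \<open>Scaling by more than \<open>norm a\<close> brings \<open>a\<close> into the unit ball; the summand \<open>1\<close> covers \<open>a = 0\<close>.\<close>
  define K where "K = norm a + 1"
  have K: "K > 0"
    by (simp add: K_def add_nonneg_pos)
  define a' where "a' = (1/K) *\<^sub>R a"
  define t where "t = a' * a'"
  have t: "unit_pos t"
    unfolding t_def using K by (intro unit_pos_square) (auto simp: a'_def star_scaleR a K_def)
  define m where "m N = (1 / real (Suc N)) *\<^sub>R (\<Sum>n<Suc N. comp_pow t n)" for N
  have comm: "comp_pow t n * a = a * comp_pow t n" for n
    by (rule comp_pow_commute[OF t]) (simp add: t_def a'_def mult.assoc)
  have m_star: "star (m N) = m N" for N
    by (simp add: m_def star_scaleR linear_sum[OF bounded_linear.linear[OF bounded_linear_star]]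
        star_comp_pow[OF t] del: sum.lessThan_Suc)
  have m_comm: "m N * a = a * m N" for N
    by (simp add: m_def sum_distrib_left sum_distrib_right comm del: sum.lessThan_Suc)
  have m_norm: "norm (m N) \<le> 2" for N
  proof -
    have "norm (\<Sum>n<Suc N. comp_pow t n) \<le> (\<Sum>n<Suc N. 2)"
      by (rule sum_norm_le) (rule norm_comp_pow_le[OF t])
    then have "norm (\<Sum>n<Suc N. comp_pow t n) \<le> 2 * real (Suc N)"
      by simp
    then show ?thesis
      by (simp add: m_def divide_le_eq del: sum.lessThan_Suc of_nat_Suc)
  qed
  have m_apply: "x - m N * x = (1 / real (Suc N)) *\<^sub>R (\<Sum>n<Suc N. x - comp_pow t n * x)" for N x
    unfolding sum_subtractf
    by (simp add: m_def sum_distrib_right scaleR_right_diff_distrib sum_constant_scaleR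
        del: sum.lessThan_Suc)
  have m_contr: "norm (x - m N * x) \<le> norm x" for N x
  proof -
    have "x - m N * x = (1 / real (Suc N)) *\<^sub>R (\<Sum>n<Suc N. x - comp_pow t n * x)"
      by (rule m_apply)
    also have "norm \<dots> \<le> (1 / real (Suc N)) * (\<Sum>n<Suc N. norm x)"
      unfolding norm_scaleR
      using sa_contractionD(2)[OF sa_contraction_funpow[OF sa_contraction_unit_pos[OF t]]]
      by (intro mult_mono sum_norm_le) (auto simp: funpow_eq_comp_pow[OF t])
    also have "\<dots> = norm x" by simp
    finally show ?thesis .
  qed
  have m_fac: "\<exists>f. m N = a * f" for N
  proof -
    have "\<exists>f. comp_pow t n = a * f" for n
    proof (induction n)
      case (Suc n)
      then obtain f where f: "comp_pow t n = a * f" by blast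
      have "comp_pow t (Suc n) = a * ((1/K) *\<^sub>R a' + f - (1/K) *\<^sub>R (a' * comp_pow t n))"
        by (simp add: t_def distrib_left right_diff_distrib f[symmetric])
          (simp add: a'_def mult.assoc)
      then show ?case by blast
    qed (auto intro: exI[of _ 0])
    then obtain f where "\<And>n. comp_pow t n = a * f n" by metis
    then have "m N = a * ((1 / real (Suc N)) *\<^sub>R (\<Sum>n<Suc N. f n))"
      by (simp add: m_def sum_distrib_left del: sum.lessThan_Suc)
    then show ?thesis by blast
  qed
  \<comment> \<open>Since \<open>(1 - t)\<^sup>n t\<close> telescopes, the Cesaro mean of the powers of \<open>1 - t\<close> kills \<open>t\<close> at rate
    \<open>2 / n\<close>.\<close>
  have m_lim: "norm (t - m N * t) \<le> 2 / real (Suc N)" for N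
  proof -
    have "(\<Sum>n<M. t - comp_pow t n * t) = comp_pow t M" for M
      using comp_pow_commute[OF t refl] by (induction M) (simp_all add: algebra_simps)
    then have "t - m N * t = (1 / real (Suc N)) *\<^sub>R comp_pow t (Suc N)"
      by (simp only: m_apply)
    then have "norm (t - m N * t) = norm (comp_pow t (Suc N)) / real (Suc N)"
      by (simp del: comp_pow.simps of_nat_Suc)
    then show ?thesis
      using norm_comp_pow_le[OF t, of "Suc N"] by (simp only: divide_right_mono of_nat_0_le_iff)
  qed
  have aa: "a * a = (K * K) *\<^sub>R t"
    using K by (simp add: t_def a'_def)
  have m_lim_a: "(\<lambda>N. a - m N * a) \<longlonglongrightarrow> 0"
  proof -
    have bound: "norm (a - m N * a) ^ 2 \<le> 3 * (K * K * (2 / real (Suc N)))" for N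
    proof -
      let ?d = "a - m N * a"
      have "star ?d = a - a * m N"
        by (simp add: star_diff star_mult a m_star)
      then have "?d * star ?d = (a * a - m N * (a * a)) - (a * a - m N * (a * a)) * m N"
        by (simp only: left_diff_distrib right_diff_distrib mult.assoc)
      also have "\<dots> = (K * K) *\<^sub>R ((t - m N * t) - (t - m N * t) * m N)"
        by (simp add: aa left_diff_distrib scaleR_right_diff_distrib)
      finally have "norm (?d * star ?d) \<le> K * K * (norm (t - m N * t) + norm (t - m N * t) * norm (m N))"
        using K by (simp add: mult_left_mono order.trans[OF norm_triangle_ineq4 add_left_mono[OF norm_mult_ineq]])
      also have "\<dots> \<le> K * K * (2 / real (Suc N) + 2 / real (Suc N) * 2)"
        using K m_lim[of N] m_norm[of N] by (intro mult_left_mono add_mono mult_mono) auto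
      finally show ?thesis
        using cstar_identity[of "star ?d"] by (simp add: star_star algebra_simps)
    qed
    have "(\<lambda>N. norm (a - m N * a) ^ 2) \<longlonglongrightarrow> 0"
    proof (rule Lim_null_comparison[where g = "\<lambda>N. 6 * (K * K) * inverse (real (Suc N))", rotated])
      show "(\<lambda>N. 6 * (K * K) * inverse (real (Suc N))) \<longlonglongrightarrow> 0"
        using tendsto_mult_right_zero[OF LIMSEQ_inverse_real_of_nat] by blast
    qed (use bound in \<open>simp add: divide_inverse mult_ac\<close>)
    then show ?thesis
      by (rule tendsto_zero_if_norm_square)
  qed
  define e where "e N = m N + m N - m N * m N" for N
  have M: "sa_contraction (\<lambda>x. x - m N * x)" for N
    using m_star[of N] m_contr[of _ N]
    by (intro sa_contraction_unit_pos) (simp add: unit_pos_def)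
  have ee: "x - e N * x = (x - m N * x) - m N * (x - m N * x)" for N x
    by (simp add: e_def algebra_simps)
  show thesis
  proof
    show e_star: "star (e N) = e N" for N
      by (simp add: e_def star_add star_diff star_mult m_star)
    have "norm (x - (x - e N * x)) \<le> norm x" for N x
      using norm_id_minus_square_le[OF M, of x N] by (simp only: ee)
    from this[of "e N" N for N] have sq: "norm (e N) * norm (e N) \<le> norm (e N)" for N
      using selfadj_norm_square[OF e_star] by (simp add: power2_eq_square)
    show "norm (e N) \<le> 1" for N
      using sq[of N] by (cases "e N = 0") auto
    show "\<exists>f. e N = a * f" for N
    proof -
      obtain f where "m N = a * f" using m_fac by blast
      then have "e N = a * (f + f - f * m N)"
        by (simp add: e_def distrib_left right_diff_distrib mult.assoc)
      then show ?thesis by blast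
    qed
    show "e N * a = a * e N" for N
    proof -
      have "m N * m N * a = a * (m N * m N)" by (intro commute_mult m_comm)
      then show ?thesis
        by (simp add: e_def distrib_left distrib_right left_diff_distrib right_diff_distrib m_comm)
    qed
    show contr: "norm (x - e N * x) \<le> norm x" for N x
      using m_contr[of "x - m N * x" N] m_contr[of x N] by (simp add: ee)
    show "(\<lambda>N. a - e N * a) \<longlonglongrightarrow> 0"
    proof (rule Lim_null_comparison[OF _ tendsto_norm_zero[OF m_lim_a]])
      show "\<forall>\<^sub>F N in sequentially. norm (a - e N * a) \<le> norm (a - m N * a)"
        by (simp add: ee m_contr)
    qed
  qed
qed

text \<open>
  An approximate unit for \<open>a = b b\<^sup>*\<close> is one for \<open>b\<close>, as
  \<open>\<parallel>(1 - e) b\<parallel>\<^sup>2 = \<parallel>(1 - e) a (1 - e)\<parallel>\<close>.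
\<close>

lemma left_approx_unit:
  fixes b :: "'a::cstar_algebra"
  obtains u :: "nat \<Rightarrow> 'a" where "\<And>n. star (u n) = u n" "\<And>n. norm (u n) \<le> 1"
    "(\<lambda>n. b - u n * b) \<longlonglongrightarrow> 0"
proof -
  define a where "a = b * star b"
  have a: "star a = a"
    by (simp add: a_def star_mult star_star)
  obtain e where e: "\<And>n. star (e n) = e n" "\<And>n. norm (e n) \<le> 1"
    and lim: "(\<lambda>n. a - e n * a) \<longlonglongrightarrow> 0"
    using selfadj_approx_unit[OF a] by metis
  have bound: "norm (b - e n * b) ^ 2 \<le> 2 * norm (a - e n * a)" for n
  proof -
    let ?d = "a - e n * a"
    have "(b - e n * b) * star (b - e n * b) = ?d - ?d * e n"
      by (simp add: a_def star_diff star_mult e left_diff_distrib right_diff_distrib mult.assoc)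
    then have "norm (b - e n * b) ^ 2 = norm (?d - ?d * e n)"
      using cstar_identity[of "star (b - e n * b)"] by (simp add: star_star)
    also have "\<dots> \<le> norm ?d + norm ?d * norm (e n)"
      using norm_triangle_ineq4[of ?d "?d * e n"] norm_mult_ineq[of ?d "e n"] by linarith
    also have "\<dots> \<le> norm ?d + norm ?d * 1"
      by (intro add_left_mono mult_left_mono e) auto
    finally show ?thesis by simp
  qed
  have "(\<lambda>n. norm (b - e n * b) ^ 2) \<longlonglongrightarrow> 0"
  proof (rule Lim_null_comparison)
    show "\<forall>\<^sub>F n in sequentially. norm (norm (b - e n * b) ^ 2) \<le> 2 * norm (a - e n * a)"
      using bound by simp
    show "(\<lambda>n. 2 * norm (a - e n * a)) \<longlonglongrightarrow> 0"
      by (rule tendsto_mult_right_zero[OF tendsto_norm_zero[OF lim]])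
  qed
  then have "(\<lambda>n. b - e n * b) \<longlonglongrightarrow> 0"
    by (rule tendsto_zero_if_norm_square)
  with e that show thesis by blast
qed

section \<open>Hilbert spaces\<close>

text \<open>
  The common core of all Cauchy-Schwarz inequalities below: \<open>\<alpha>\<close>, \<open>\<beta>\<close>, \<open>\<gamma>\<close> are the entries of a
  sesquilinear form on two vectors, and the quadratic is its value on the first plus \<open>z\<close> times the
  second.
\<close>

lemma cauchy_schwarz_quadratic:
  fixes \<alpha> \<gamma> :: real and \<beta> :: complex
  assumes pos: "\<And>z. 0 \<le> \<alpha> + 2 * Re (z * \<beta>) + (cmod z)\<^sup>2 * \<gamma>"
  shows "(cmod \<beta>)\<^sup>2 \<le> \<alpha> * \<gamma>"
proof -
  let ?b = "(cmod \<beta>)\<^sup>2"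
  have *: "0 \<le> \<alpha> - 2 * s * ?b + s\<^sup>2 * ?b * \<gamma>" for s
  proof -
    have "Re (- complex_of_real s * cnj \<beta> * \<beta>) = - s * ?b"
      by (simp add: cmod_power2) (simp add: power2_eq_square algebra_simps)
    moreover have "(cmod (- complex_of_real s * cnj \<beta>))\<^sup>2 = s\<^sup>2 * ?b"
      by (simp add: norm_mult power_mult_distrib)
    ultimately show ?thesis
      using pos[of "- complex_of_real s * cnj \<beta>"] by (simp add: algebra_simps)
  qed
  show ?thesis
  proof (cases "\<gamma> > 0")
    case True
    then show ?thesis
      using *[of "1/\<gamma>"] by (simp add: field_simps power2_eq_square)
  next
    case False
    have "?b = 0"
    proof (rule ccontr)
      assume "?b \<noteq> 0"
      then have b: "?b > 0" by simp
      have "2 * s * ?b \<le> \<alpha>" for s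
        using *[of s] False b mult_nonneg_nonpos[of "s\<^sup>2 * ?b" \<gamma>] by simp
      from this[of "(\<bar>\<alpha>\<bar> + 1) / ?b"] b show False by simp
    qed
    moreover have "\<alpha> * \<gamma> \<ge> 0"
    proof (cases "\<gamma> = 0")
      case False
      with \<open>\<not> \<gamma> > 0\<close> have "\<gamma> < 0" by simp
      have "0 \<le> \<alpha> + r\<^sup>2 * \<gamma>" for r
        using pos[of "of_real r"] \<open>?b = 0\<close> by simp
      from this[of "sqrt ((\<bar>\<alpha>\<bar> + 1) / - \<gamma>)"] \<open>\<gamma> < 0\<close> have False
        by (simp add: divide_nonneg_neg)
      then show ?thesis ..
    qed simp
    ultimately show ?thesis by simp
  qed
qed

lemma cinner_add_left: "cinner (x + y) z = cinner x z + cinner y (z::'h::complex_hilbert)"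
  by (metis cinner_add_right cnj_cinner complex_cnj_add)

lemma cinner_scaleC_left: "cinner (c *\<^sub>C x) y = cnj c * cinner x (y::'h::complex_hilbert)"
  by (metis cinner_scaleC_right cnj_cinner complex_cnj_mult)

lemma cinner_zero_right [simp]: "cinner (x::'h::complex_hilbert) 0 = 0"
  using cinner_scaleC_right[of x 0 0] by simp

lemma cinner_minus_right: "cinner x (- y) = - cinner x (y::'h::complex_hilbert)"
  using cinner_scaleC_right[of x "-1" y] by (simp add: scaleC_minus_one)

lemma cinner_minus_left: "cinner (- x) y = - cinner x (y::'h::complex_hilbert)"
  using cinner_scaleC_left[of "-1" x y] by (simp add: scaleC_minus_one)

lemma cinner_diff_right: "cinner x (y - z) = cinner x y - cinner x (z::'h::complex_hilbert)"
  using cinner_add_right[of x y "- z"] by (simp add: cinner_minus_right)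

lemma cinner_diff_left: "cinner (x - y) z = cinner x z - cinner y (z::'h::complex_hilbert)"
  using cinner_add_left[of x "- y" z] by (simp add: cinner_minus_left)

lemma cinner_self: "cinner x x = of_real ((norm (x::'h::complex_hilbert))\<^sup>2)"
  using cinner_self_nonneg[of x]
  by (auto simp: norm_cinner nonneg_Reals_def norm_mult power2_eq_square)

lemma norm_square_cinner: "(norm (x::'h::complex_hilbert))\<^sup>2 = Re (cinner x x)"
  by (simp add: cinner_self)

lemma norm_add_square:
  "(norm (x + y))\<^sup>2 = (norm x)\<^sup>2 + 2 * Re (cinner x y) + (norm (y::'h::complex_hilbert))\<^sup>2"
proof -
  have "Re (cinner y x) = Re (cinner x y)"
    using arg_cong[OF cnj_cinner[of y x], of Re] by simp
  then show ?thesis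
    by (simp add: norm_square_cinner cinner_add_left cinner_add_right)
qed

lemma cauchy_schwarz_cinner: "cmod (cinner x y) \<le> norm x * norm (y::'h::complex_hilbert)"
proof -
  have "(cmod (cinner x y))\<^sup>2 \<le> (norm x)\<^sup>2 * (norm y)\<^sup>2"
  proof (rule cauchy_schwarz_quadratic)
    fix z
    show "0 \<le> (norm x)\<^sup>2 + 2 * Re (z * cinner x y) + (cmod z)\<^sup>2 * (norm y)\<^sup>2"
      using norm_add_square[of x "z *\<^sub>C y"] zero_le_power2[of "norm (x + z *\<^sub>C y)"]
      by (simp add: cinner_scaleC_right norm_scaleC power_mult_distrib)
  qed
  then show ?thesis
    by (simp add: abs_le_square_iff flip: power_mult_distrib)
qed

lemma eq_if_cinner_eq: "(\<And>z. cinner z x = cinner z y) \<Longrightarrow> x = (y::'h::complex_hilbert)"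
proof -
  assume "\<And>z. cinner z x = cinner z y"
  then have "cinner (x - y) (x - y) = 0"
    by (simp add: cinner_diff_right)
  then show "x = y"
    by (simp add: cinner_self)
qed

lemma bounded_linear_cinner_right: "bounded_linear (cinner (x::'h::complex_hilbert))"
proof (rule bounded_linear_intro[where K = "norm x"])
  show "cinner x (r *\<^sub>R y) = r *\<^sub>R cinner x y" for r y
    by (simp add: scaleR_scaleC cinner_scaleC_right scaleR_conv_of_real)
  show "norm (cinner x y) \<le> norm y * norm x" for y
    using cauchy_schwarz_cinner[of x y] by (simp add: mult.commute)
qed (rule cinner_add_right)

text \<open>
  The functional \<open>J x = \<parallel>x\<parallel>\<^sup>2 - 2 Re (F x)\<close> is bounded below; by the parallelogram law its minimising
  sequences are Cauchy, and stationarity of \<open>J\<close> at a minimiser \<open>g\<close> says \<open>F = \<langle>g, \<cdot>\<rangle>\<close>.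
\<close>

lemma riesz_representation:
  fixes F :: "'h::complex_hilbert \<Rightarrow> complex"
  assumes F: "bounded_linear F" and Fc: "\<And>c x. F (c *\<^sub>C x) = c * F x"
  obtains g where "\<And>x. F x = cinner g x"
proof -
  note lin = bounded_linear.linear[OF F]
  obtain K where K: "\<And>x. norm (F x) \<le> norm x * K"
    using bounded_linear.bounded[OF F] by blast
  define J where "J x = (norm x)\<^sup>2 - 2 * Re (F x)" for x
  have lower: "J x \<ge> - K\<^sup>2" for x
  proof -
    have "Re (F x) \<le> norm x * K"
      using K[of x] complex_Re_le_cmod order_trans by blast
    then show ?thesis
      using zero_le_power2[of "norm x - K"] by (simp add: J_def power2_diff)
  qed
  have bdd: "bdd_below (range J)"
    using lower by (auto intro!: bdd_belowI)
  define m where "m = Inf (range J)"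
  have m_le: "m \<le> J x" for x
    unfolding m_def by (rule cInf_lower[OF _ bdd]) simp
  have "\<exists>x. J x < m + 1 / real (Suc n)" for n
  proof -
    have "Inf (range J) < m + 1 / real (Suc n)"
      by (simp add: m_def)
    then show ?thesis
      using cInf_lessD[of "range J"] by blast
  qed
  then obtain y where y: "\<And>n. J (y n) < m + 1 / real (Suc n)"
    by metis
  have par: "(norm (u - v))\<^sup>2 = 2 * J u + 2 * J v - 4 * J ((1/2) *\<^sub>R (u + v))" for u v
  proof -
    have "(norm (u + v))\<^sup>2 + (norm (u - v))\<^sup>2 = 2 * (norm u)\<^sup>2 + 2 * (norm v)\<^sup>2"
      using norm_add_square[of u v] norm_add_square[of u "- v"] by (simp add: cinner_minus_right)
    moreover have "J ((1/2) *\<^sub>R w) = (norm w)\<^sup>2 / 4 - Re (F w)" for w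
      by (simp add: J_def linear_scale[OF lin] power_divide)
    then have "4 * J ((1/2) *\<^sub>R (u + v)) = (norm (u + v))\<^sup>2 - 4 * Re (F u) - 4 * Re (F v)"
      by (simp add: linear_add[OF lin])
    ultimately show ?thesis
      by (simp add: J_def)
  qed
  have diff: "(norm (y i - y j))\<^sup>2 \<le> 4 / real (Suc n)" if "n \<le> i" "n \<le> j" for n i j
  proof -
    have "1 / real (Suc i) \<le> 1 / real (Suc n)" "1 / real (Suc j) \<le> 1 / real (Suc n)"
      using that by (simp_all add: frac_le)
    then show ?thesis
      using par[of "y i" "y j"] y[of i] y[of j] m_le[of "(1/2) *\<^sub>R (y i + y j)"] by simp
  qed
  have "Cauchy y"
  proof (rule metric_CauchyI)
    fix \<epsilon> :: real assume \<epsilon>: "0 < \<epsilon>"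
    then obtain n where n: "inverse (real (Suc n)) < \<epsilon>\<^sup>2 / 4"
      using reals_Archimedean[of "\<epsilon>\<^sup>2 / 4"] by auto
    have "dist (y i) (y j) < \<epsilon>" if "n \<le> i" "n \<le> j" for i j
    proof -
      have "(norm (y i - y j))\<^sup>2 < \<epsilon>\<^sup>2"
        using diff[OF that] n by (simp add: inverse_eq_divide)
      then show ?thesis
        using \<epsilon> by (simp add: dist_norm power2_less_imp_less)
    qed
    then show "\<exists>M. \<forall>i\<ge>M. \<forall>j\<ge>M. dist (y i) (y j) < \<epsilon>" by blast
  qed
  then obtain g where g: "y \<longlonglongrightarrow> g"
    using Cauchy_convergent convergentD by blast
  have "(\<lambda>n. J (y n)) \<longlonglongrightarrow> J g"
    unfolding J_def by (intro tendsto_intros g bounded_linear.tendsto[OF F])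
  moreover have "(\<lambda>n. m + 1 / real (Suc n)) \<longlonglongrightarrow> m + 0"
    using tendsto_add[OF tendsto_const LIMSEQ_inverse_real_of_nat] by (simp add: inverse_eq_divide)
  ultimately have Jg: "J g \<le> m"
    using LIMSEQ_le[of "\<lambda>n. J (y n)" "J g" "\<lambda>n. m + 1 / real (Suc n)" "m + 0"] y less_imp_le by auto
  have "F x = cinner g x" for x
  proof -
    define \<beta> where "\<beta> = cinner g x - F x"
    have "(cmod \<beta>)\<^sup>2 \<le> 0 * (norm x)\<^sup>2"
    proof (rule cauchy_schwarz_quadratic)
      fix z
      have "J g \<le> J (g + z *\<^sub>C x)"
        using Jg m_le order_trans by blast
      then show "0 \<le> 0 + 2 * Re (z * \<beta>) + (cmod z)\<^sup>2 * (norm x)\<^sup>2"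
        unfolding J_def norm_add_square
        by (simp add: linear_add[OF lin] Fc cinner_scaleC_right norm_scaleC power_mult_distrib
            \<beta>_def right_diff_distrib del: times_complex.simps)
    qed
    then show ?thesis by (simp add: \<beta>_def)
  qed
  then show thesis by (rule that)
qed

lemma cadjoint_cinner:
  fixes f :: "'h::complex_hilbert \<Rightarrow> 'k::complex_hilbert"
  assumes "f \<in> bounded_ops"
  shows "cinner (cadjoint f k) h = cinner k (f h)"
proof -
  have f: "bounded_linear f" "\<And>c x. f (c *\<^sub>C x) = c *\<^sub>C f x"
    using assms by (auto simp: bounded_ops_def)
  have "\<exists>g. \<forall>h. cinner k (f h) = cinner g h" for k
    using riesz_representation[OF bounded_linear_compose[OF bounded_linear_cinner_right f(1)], of k]
    by (metis f(2) cinner_scaleC_right)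
  then obtain g where g: "\<forall>h k. cinner (g k) h = cinner k (f h)"
    by metis
  have "\<exists>!g. \<forall>h k. cinner (g k) h = cinner k (f h)"
  proof (rule ex1I[where a = g])
    show "\<forall>h k. cinner (g k) h = cinner k (f h)" by (rule g)
  next
    fix g' assume "\<forall>h k. cinner (g' k) h = cinner k (f h)"
    then show "g' = g"
      using g by (intro ext eq_if_cinner_eq) (metis cnj_cinner)
  qed
  then have "\<forall>h k. cinner (cadjoint f k) h = cinner k (f h)"
    unfolding cadjoint_def by (rule theI')
  then show ?thesis by blast
qed

lemma cinner_cadjoint_right:
  assumes "f \<in> bounded_ops"
  shows "cinner h (cadjoint f k) = cinner (f h) k"
  using cadjoint_cinner[OF assms] by (metis cnj_cinner)

section \<open>Completely positive maps\<close>

lemma Re_norm_square_mult: "Re (z * cnj z * w) = (cmod z)\<^sup>2 * Re w"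
  by (simp add: cmod_power2) (simp add: power2_eq_square algebra_simps)

locale cp_map =
  fixes \<phi> :: "'a::cstar_algebra \<Rightarrow> 'h \<Rightarrow> 'h::complex_hilbert"
  assumes phi_ops: "\<phi> a \<in> bounded_ops"
    and phi_linear: "linear_op_map \<phi>"
    and phi_cp: "completely_positive \<phi>"
begin

lemma phi_add: "\<phi> (a + b) h = \<phi> a h + \<phi> b h"
  using phi_linear by (simp add: linear_op_map_def)

lemma phi_scaleC: "\<phi> (c *\<^sub>C a) h = c *\<^sub>C \<phi> a h"
  using phi_linear by (simp add: linear_op_map_def)

lemma phi_minus: "\<phi> (- a) h = - \<phi> a h"
  using phi_scaleC[of "-1" a h] by (simp add: scaleC_minus_one)

lemma phi_diff: "\<phi> (a - b) h = \<phi> a h - \<phi> b h"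
  using phi_add[of a "- b"] by (simp add: phi_minus)

lemma bounded_linear_phi: "bounded_linear (\<phi> a)"
  using phi_ops by (simp add: bounded_ops_def)

lemma phi_vec_scaleC: "\<phi> a (c *\<^sub>C h) = c *\<^sub>C \<phi> a h"
  using phi_ops[of a] by (simp add: bounded_ops_def)


text \<open>
  The matrix with entries \<open>b\<^sub>i\<^sup>* b\<^sub>j\<close> is \<open>B\<^sup>* B\<close> for the matrix \<open>B\<close> with first row \<open>b\<close> and zeros
  elsewhere.
\<close>

lemma cp_form:
  fixes n :: nat
  shows "(\<Sum>i<n. \<Sum>j<n. cinner (h i) (\<phi> (star (b i) * b j) (h j))) \<in> \<real>\<^sub>\<ge>\<^sub>0"
proof -
  have "positive_matrix n (\<lambda>i j. star (b i) * b j)"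
    unfolding positive_matrix_def
  proof (intro exI[of _ "\<lambda>k i. if k = 0 then b i else 0"] allI impI)
    fix i j assume "i < n" "j < n"
    have "(\<Sum>k<n. star (if k = 0 then b i else 0) * (if k = 0 then b j else 0))
        = (\<Sum>k<n. if k = 0 then star (b i) * b j else 0)"
      by (rule sum.cong) auto
    with \<open>i < n\<close> show "star (b i) * b j
        = (\<Sum>k<n. star (if k = 0 then b i else 0) * (if k = 0 then b j else 0))"
      by simp
  qed
  then show ?thesis
    using phi_cp by (auto simp: completely_positive_def positive_op_matrix_def)
qed

lemma cp_positive: "cinner h (\<phi> (star b * b) h) \<in> \<real>\<^sub>\<ge>\<^sub>0"
  using cp_form[where n = 1 and h = "\<lambda>_. h" and b = "\<lambda>_. b"] by simp

lemma cp_two_form: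
  "cinner g (\<phi> (star b * b) g) + z * cinner g (\<phi> (star b * c) h)
    + cnj z * cinner h (\<phi> (star c * b) g)
    + z * cnj z * cinner h (\<phi> (star c * c) h) \<in> \<real>\<^sub>\<ge>\<^sub>0"
proof -
  have "{..<2} = {0, 1::nat}" by auto
  then show ?thesis
    using cp_form[where n = 2 and h = "\<lambda>i. if i = 0 then g else z *\<^sub>C h"
        and b = "\<lambda>i. if i = 0 then b else c"]
    by (simp add: phi_vec_scaleC cinner_scaleC_left cinner_scaleC_right add_ac mult_ac)
qed

lemma cp_hermitian: "cinner h (\<phi> (star c * b) g) = cnj (cinner g (\<phi> (star b * c) h))"
proof -
  let ?\<beta> = "cinner g (\<phi> (star b * c) h)" and ?\<gamma> = "cinner h (\<phi> (star c * b) g)"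
  have "Im ?\<beta> + Im ?\<gamma> = 0" "Re ?\<beta> - Re ?\<gamma> = 0"
    using cp_two_form[of g b 1 c h] cp_two_form[of g b \<i> c h] cp_positive[of g b] cp_positive[of h c]
    by (auto simp: complex_nonneg_Reals_iff)
  then show ?thesis
    by (simp add: complex_eq_iff)
qed

lemma cp_cauchy_schwarz:
  "(cmod (cinner g (\<phi> (star b * c) h)))\<^sup>2
    \<le> Re (cinner g (\<phi> (star b * b) g)) * Re (cinner h (\<phi> (star c * c) h))"
proof (rule cauchy_schwarz_quadratic)
  fix z
  let ?\<beta> = "cinner g (\<phi> (star b * c) h)"
  have "Re (cnj z * cnj ?\<beta>) = Re (z * ?\<beta>)"
    by (simp flip: complex_cnj_mult)
  then show "0 \<le> Re (cinner g (\<phi> (star b * b) g)) + 2 * Re (z * ?\<beta>)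
      + (cmod z)\<^sup>2 * Re (cinner h (\<phi> (star c * c) h))"
    using cp_two_form[of g b z c h] unfolding cp_hermitian[of h c b g] complex_nonneg_Reals_iff
    by (simp add: Re_norm_square_mult del: times_complex.simps)
qed

text \<open>
  Complete positivity gives this at the products \<open>b\<^sup>* c\<close>, and self-adjoint elements are differences of
  squares.
\<close>

lemma phi_star: "cinner g (\<phi> (star a) h) = cinner (\<phi> a g) h"
proof -
  have sa: "cinner g (\<phi> a h) = cinner (\<phi> a g) h" if a: "star a = a" for a
  proof -
    obtain s u where su: "star s = s" "star u = u" "a = s * s - u * u"
      using selfadj_diff_squares[OF a] by metis
    have "cinner g (\<phi> (s * s) h) = cinner (\<phi> (s * s) g) h" if "star s = s" for s
      using cp_hermitian[of g s s h] that cnj_cinner by metis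
    with su show ?thesis
      by (simp add: phi_diff cinner_diff_left cinner_diff_right)
  qed
  obtain p q where "star p = p" "star q = q" "a = p + \<i> *\<^sub>C q" "star a = p - \<i> *\<^sub>C q"
    using selfadj_real_part[of a] by metis
  then show ?thesis
    by (simp add: phi_add phi_diff phi_scaleC cinner_add_left cinner_diff_right cinner_scaleC_left
        cinner_scaleC_right sa)
qed

lemma cadjoint_phi: "cadjoint (\<phi> a) = \<phi> (star a)"
proof (rule ext, rule eq_if_cinner_eq)
  fix h z
  show "cinner z (cadjoint (\<phi> a) h) = cinner z (\<phi> (star a) h)"
    by (simp add: cinner_cadjoint_right[OF phi_ops] phi_star)
qed

text \<open>
  The functionals \<open>\<langle>k, \<phi> \<cdot> k\<rangle>\<close> are positive, hence bounded on squares. Cauchy-Schwarz extends the bound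
  to \<open>\<langle>g, \<phi> \<cdot> h\<rangle>\<close> on squares, and elements are combinations of four squares of norm at most
  \<open>\<parallel>d\<parallel>\<close>.
\<close>

lemma phi_weakly_bounded:
  obtains C where "C \<ge> 0" "\<And>d. cmod (cinner g (\<phi> d h)) \<le> C * norm d"
proof -
  have sq: "\<exists>C\<ge>0. \<forall>s. star s = s \<longrightarrow> Re (cinner k (\<phi> (s * s) k)) \<le> C * (norm s)\<^sup>2" for k
  proof -
    have "linear (\<lambda>d. Re (cinner k (\<phi> d k)))"
      by (rule linearI) (simp_all add: phi_add phi_scaleC cinner_add_right scaleR_scaleC
          cinner_scaleC_right)
    moreover have "0 \<le> Re (cinner k (\<phi> (s * s) k))" if "star s = s" for s
      using cp_positive[of k s] that by (simp add: complex_nonneg_Reals_iff)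
    ultimately show ?thesis
      using positive_functional_bounded by metis
  qed
  obtain G where G: "G \<ge> 0" "\<And>s. star s = s \<Longrightarrow> Re (cinner g (\<phi> (s * s) g)) \<le> G * (norm s)\<^sup>2"
    using sq[of g] by blast
  obtain H where H: "H \<ge> 0" "\<And>s. star s = s \<Longrightarrow> Re (cinner h (\<phi> (s * s) h)) \<le> H * (norm s)\<^sup>2"
    using sq[of h] by blast
  define C where "C = G + H"
  have C: "C \<ge> 0" using G H by (simp add: C_def)
  have square: "cmod (cinner g (\<phi> (s * s) h)) \<le> C * norm (s * s)" if s: "star s = s" for s
  proof -
    have "(cmod (cinner g (\<phi> (s * s) h)))\<^sup>2 \<le> (G * (norm s)\<^sup>2) * (H * (norm s)\<^sup>2)"
      using cp_cauchy_schwarz[of g s s h] mult_mono[OF G(2)[OF s] H(2)[OF s]] G(1)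
        cp_positive[of h s] s
      by (simp add: complex_nonneg_Reals_iff)
    also have "\<dots> \<le> (C * (norm s)\<^sup>2)\<^sup>2"
    proof -
      have "G * H \<le> C\<^sup>2"
        using G(1) H(1) by (simp add: C_def power2_sum)
      then have "(G * H) * ((norm s)\<^sup>2 * (norm s)\<^sup>2) \<le> C\<^sup>2 * ((norm s)\<^sup>2 * (norm s)\<^sup>2)"
        by (rule mult_right_mono) simp
      then show ?thesis
        by (simp only: power2_eq_square mult_ac)
    qed
    finally have "cmod (cinner g (\<phi> (s * s) h)) \<le> C * (norm s)\<^sup>2"
      by (rule power2_le_imp_le) (simp add: C)
    then show ?thesis
      by (simp add: selfadj_norm_square[OF s])
  qed
  have sa: "cmod (cinner g (\<phi> a h)) \<le> 2 * C * norm a" if a: "star a = a" for a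
  proof -
    obtain s u where su: "star s = s" "star u = u" "a = s * s - u * u"
      "norm (s * s) \<le> norm a" "norm (u * u) \<le> norm a"
      by (rule selfadj_diff_squares[OF a])
    have "cmod (cinner g (\<phi> a h)) \<le> C * norm (s * s) + C * norm (u * u)"
      unfolding su(3) phi_diff cinner_diff_right
      using norm_triangle_ineq4 square[OF su(1)] square[OF su(2)] by (meson add_mono order_trans)
    also have "\<dots> \<le> C * norm a + C * norm a"
      by (intro add_mono mult_left_mono su C)
    finally show ?thesis by simp
  qed
  have "cmod (cinner g (\<phi> d h)) \<le> 4 * C * norm d" for d
  proof -
    obtain p q where pq: "star p = p" "star q = q" "d = p + \<i> *\<^sub>C q"
      "norm p \<le> norm d" "norm q \<le> norm d"
      by (rule selfadj_real_part)
    have "cmod (cinner g (\<phi> d h)) \<le> cmod (cinner g (\<phi> p h)) + cmod (cinner g (\<phi> q h))"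
      unfolding pq(3) phi_add phi_scaleC cinner_add_right cinner_scaleC_right
      using norm_triangle_ineq[of "cinner g (\<phi> p h)" "\<i> * cinner g (\<phi> q h)"]
      by (simp add: norm_mult)
    also have "\<dots> \<le> 2 * C * norm p + 2 * C * norm q"
      by (intro add_mono sa pq)
    also have "\<dots> \<le> 2 * C * norm d + 2 * C * norm d"
      using C by (intro add_mono mult_left_mono pq) auto
    finally show ?thesis by simp
  qed
  with C show thesis
    using that[of "4 * C"] by simp
qed

end

section \<open>Contractive completely positive maps\<close>

text \<open>
  The failure of equality in the Kadison-Schwarz inequality \<open>\<phi> (b)\<^sup>* \<phi> (b) \<le> \<phi> (b\<^sup>* b)\<close>, polarised. For
  contractive completely positive \<open>\<phi>\<close> it is a positive semidefinite form in \<open>b\<close> and \<open>c\<close>.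
\<close>

definition schwarz_defect ::
  "('a::cstar_algebra \<Rightarrow> 'h \<Rightarrow> 'h::complex_hilbert) \<Rightarrow> 'h \<Rightarrow> 'a \<Rightarrow> 'a \<Rightarrow> complex" where
  "schwarz_defect \<phi> h b c = cinner h (\<phi> (star b * c) h) - cinner (\<phi> b h) (\<phi> c h)"

locale contractive_cp_map = cp_map +
  assumes contr: "contractive \<phi>"
begin

lemma norm_phi_le: "norm (\<phi> a h) \<le> norm a * norm h"
  using onorm[OF bounded_linear_phi, of a h] contr
  by (meson contractive_def mult_right_mono norm_ge_zero order_trans)

lemma cmod_cinner_phi_le: "cmod (cinner g (\<phi> a h)) \<le> norm g * norm a * norm h"
  using cauchy_schwarz_cinner[of g "\<phi> a h"] mult_left_mono[OF norm_phi_le[of a h], of "norm g"]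
  by simp

lemma tendsto_cinner_phi:
  assumes "d \<longlonglongrightarrow> b"
  shows "(\<lambda>n. cinner g (\<phi> (d n) h)) \<longlonglongrightarrow> cinner g (\<phi> b h)"
proof -
  have "bounded_linear (\<lambda>d. cinner g (\<phi> d h))"
    by (rule bounded_linear_intro[where K = "norm g * norm h"])
      (use cmod_cinner_phi_le[of g _ h] in \<open>simp_all add: phi_add phi_scaleC cinner_add_right
        scaleR_scaleC cinner_scaleC_right scaleR_conv_of_real mult_ac\<close>)
  then show ?thesis
    using assms bounded_linear.tendsto by blast
qed

text \<open>
  For an approximate unit \<open>u\<close> of \<open>b\<close>, Cauchy-Schwarz bounds \<open>\<bar>\<langle>k, \<phi> (u b) h\<rangle>\<bar>\<^sup>2\<close> by
  \<open>\<langle>k, \<phi> (u\<^sup>2) k\<rangle> \<langle>h, \<phi> (b\<^sup>* b) h\<rangle>\<close>, and \<open>\<langle>k, \<phi> (u\<^sup>2) k\<rangle> \<le> \<parallel>k\<parallel>\<^sup>2\<close> by contractivity. Take \<open>k = \<phi> b h\<close>.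
\<close>

lemma kadison_schwarz: "(norm (\<phi> b h))\<^sup>2 \<le> Re (cinner h (\<phi> (star b * b) h))"
proof -
  let ?R = "Re (cinner h (\<phi> (star b * b) h))" and ?k = "\<phi> b h"
  have R: "?R \<ge> 0"
    using cp_positive[of h b] by (simp add: complex_nonneg_Reals_iff)
  obtain u where u: "\<And>n. star (u n) = u n" "\<And>n. norm (u n) \<le> 1"
    and lim: "(\<lambda>n. b - u n * b) \<longlonglongrightarrow> 0"
    using left_approx_unit[of b] by metis
  have "(\<lambda>n. b - (b - u n * b)) \<longlonglongrightarrow> b - 0"
    by (intro tendsto_intros lim)
  then have "(\<lambda>n. u n * b) \<longlonglongrightarrow> b" by simp
  then have lim': "(\<lambda>n. (cmod (cinner ?k (\<phi> (u n * b) h)))\<^sup>2) \<longlonglongrightarrow> (cmod (cinner ?k (\<phi> b h)))\<^sup>2"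
    by (intro tendsto_intros tendsto_cinner_phi)
  have "(cmod (cinner ?k (\<phi> (u n * b) h)))\<^sup>2 \<le> (norm ?k)\<^sup>2 * ?R" for n
  proof -
    have "Re (cinner ?k (\<phi> (u n * u n) ?k)) \<le> norm ?k * norm (u n * u n) * norm ?k"
      using cmod_cinner_phi_le[of ?k "u n * u n" ?k] complex_Re_le_cmod order_trans by blast
    also have "\<dots> \<le> norm ?k * 1 * norm ?k"
      using u by (intro mult_right_mono mult_left_mono) (auto simp: selfadj_norm_square power_le_one)
    finally have "Re (cinner ?k (\<phi> (u n * u n) ?k)) \<le> (norm ?k)\<^sup>2"
      by (simp add: power2_eq_square)
    then show ?thesis
      using cp_cauchy_schwarz[of ?k "u n" b h] u(1)[of n] mult_right_mono[OF _ R] by fastforce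
  qed
  then have "(cmod (cinner ?k (\<phi> b h)))\<^sup>2 \<le> (norm ?k)\<^sup>2 * ?R"
    by (intro LIMSEQ_le_const2[OF lim']) auto
  moreover have "cmod (cinner ?k ?k) = (norm ?k)\<^sup>2"
    by (simp add: cinner_self norm_power)
  ultimately have le: "(norm ?k)\<^sup>2 * (norm ?k)\<^sup>2 \<le> (norm ?k)\<^sup>2 * ?R"
    by (simp only: power2_eq_square)
  show ?thesis
  proof (cases "?k = 0")
    case False
    then have "0 < (norm ?k)\<^sup>2" by simp
    then show ?thesis using le mult_le_cancel_left_pos by blast
  qed (use R in simp)
qed

lemma schwarz_defect_self_nonneg: "0 \<le> Re (schwarz_defect \<phi> h b b)"
  using kadison_schwarz[where b = b and h = h] by (simp add: schwarz_defect_def cinner_self)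

lemma schwarz_defect_cauchy_schwarz:
  "(cmod (schwarz_defect \<phi> h b c))\<^sup>2
    \<le> Re (schwarz_defect \<phi> h b b) * Re (schwarz_defect \<phi> h c c)"
proof (rule cauchy_schwarz_quadratic)
  fix z
  let ?q = "schwarz_defect \<phi> h"
  have herm: "?q c b = cnj (?q b c)"
    by (simp add: schwarz_defect_def cp_hermitian[of h c b h] cnj_cinner)
  have "?q (b + z *\<^sub>C c) (b + z *\<^sub>C c)
      = ?q b b + z * ?q b c + cnj z * ?q c b + z * cnj z * ?q c c"
    by (simp add: schwarz_defect_def star_add star_scaleC distrib_left distrib_right
        mult_scaleC_left mult_scaleC_right phi_add phi_scaleC cinner_add_left cinner_add_right
        cinner_scaleC_left cinner_scaleC_right scaleC_scaleC)
      (simp add: algebra_simps)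
  moreover have "Re (cnj z * cnj (?q b c)) = Re (z * ?q b c)"
    by (simp flip: complex_cnj_mult)
  ultimately show "0 \<le> Re (?q b b) + 2 * Re (z * ?q b c) + (cmod z)\<^sup>2 * Re (?q c c)"
    using schwarz_defect_self_nonneg[of h "b + z *\<^sub>C c"] unfolding herm
    by (simp add: Re_norm_square_mult del: times_complex.simps)
qed

text \<open>
  The hypothesis makes the Schwarz defect of \<open>a\<close> with itself zero at every vector, hence by
  Cauchy-Schwarz also its defect with every \<open>b\<close>. This gives equality of the quadratic forms of
  \<open>\<phi> (a b)\<close> and \<open>\<phi> a \<phi> b\<close>, and operators are determined by their quadratic forms.
\<close>

lemma mult_domain_if_square:
  assumes a: "star a = a" and sq: "\<phi> (a * a) = \<phi> a \<circ> \<phi> a"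
  shows "a \<in> mult_domain \<phi>"
proof -
  \<comment> \<open>Polarisation: the vectors \<open>z + h\<close> and \<open>z + \<i> h\<close> isolate the matrix entry at \<open>(z, h)\<close>.\<close>
  have op_eq: "S = T" if S: "S \<in> bounded_ops" and T: "T \<in> bounded_ops"
    and eq: "\<And>h. cinner h (S h) = cinner h (T h)" for S T :: "'b \<Rightarrow> 'b"
  proof (rule ext, rule eq_if_cinner_eq)
    fix h z
    define D where "D h = S h - T h" for h
    have D: "cinner h (D h) = 0" for h
      by (simp add: D_def cinner_diff_right eq)
    have D_add: "D (x + y) = D x + D y" and D_scaleC: "D (c *\<^sub>C x) = c *\<^sub>C D x" for x y c
      using S T linear_add[OF bounded_linear.linear, of S] linear_add[OF bounded_linear.linear, of T]
      by (auto simp: D_def bounded_ops_def scaleC_diff_right)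
    have "cinner z (D h) + cinner h (D z) = 0"
      using D[of "z + h"] by (simp add: D_add cinner_add_left cinner_add_right D add.commute)
    moreover have "\<i> * cinner z (D h) - \<i> * cinner h (D z) = 0"
      using D[of "z + \<i> *\<^sub>C h"] by (simp add: D_add D_scaleC cinner_add_left cinner_add_right
          cinner_scaleC_left cinner_scaleC_right D)
    ultimately have "cinner z (D h) = 0"
      by (simp flip: right_diff_distrib)
    then show "cinner z (S h) = cinner z (T h)"
      by (simp add: D_def cinner_diff_right)
  qed
  have comp: "\<phi> b \<circ> \<phi> c \<in> bounded_ops" for b c
    using bounded_linear_compose[OF bounded_linear_phi bounded_linear_phi, of b c]
    by (simp add: bounded_ops_def phi_vec_scaleC o_def)
  have q0: "schwarz_defect \<phi> h a a = 0" for h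
    using phi_star[of h a "\<phi> a h"] by (simp add: schwarz_defect_def a sq)
  have "schwarz_defect \<phi> h a b = 0" "schwarz_defect \<phi> h (star b) a = 0" for h b
    using schwarz_defect_cauchy_schwarz[of h a b] schwarz_defect_cauchy_schwarz[of h "star b" a]
    by (simp_all add: q0)
  then have "cinner h (\<phi> (a * b) h) = cinner h (\<phi> a (\<phi> b h))"
    "cinner h (\<phi> (b * a) h) = cinner h (\<phi> b (\<phi> a h))" for h b
    using phi_star[of h a "\<phi> b h"] phi_star[of h "star b" "\<phi> a h"]
    by (simp_all add: schwarz_defect_def a star_star)
  then have "\<phi> (a * b) = \<phi> a \<circ> \<phi> b" "\<phi> (b * a) = \<phi> b \<circ> \<phi> a" for b
    by (auto intro!: op_eq phi_ops comp)
  then show ?thesis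
    by (simp add: mult_domain_def)
qed

end

section \<open>The module map\<close>

locale cp_module_map = hilbert_module act ip + cp_map \<phi>
  for act :: "'x::complex_banach \<Rightarrow> 'a::cstar_algebra \<Rightarrow> 'x"
    and ip :: "'x \<Rightarrow> 'x \<Rightarrow> 'a"
    and \<phi> :: "'a \<Rightarrow> 'h::complex_hilbert \<Rightarrow> 'h" +
  fixes \<Phi> :: "'x \<Rightarrow> 'h \<Rightarrow> 'k::complex_hilbert"
  assumes Phi_ops: "\<Phi> x \<in> bounded_ops"
    and Phi_map: "phi_map ip \<phi> \<Phi>"
begin

lemma ip_add_left: "ip (x + y) z = ip x z + ip y z"
  by (metis ip_add_right star_add star_ip)

lemma ip_scaleC_left: "ip (c *\<^sub>C x) y = cnj c *\<^sub>C ip x y"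
  by (metis ip_scaleC_right star_scaleC star_ip)

lemma ip_act_left: "ip (act x a) y = star a * ip x y"
  by (metis ip_act_right star_mult star_ip)

lemma ip_diff_right: "ip x (y - z) = ip x y - ip x z"
  using ip_add_right[of x y "- z"] ip_scaleC_right[of x "-1" z] by (simp add: scaleC_minus_one)

lemma ip_diff_left: "ip (x - y) z = ip x z - ip y z"
  using ip_add_left[of x "- y" z] ip_scaleC_left[of "-1" y z] by (simp add: scaleC_minus_one)

lemma norm_square_ip: "(norm x)\<^sup>2 = norm (ip x x)"
  by (simp add: norm_ip)

lemma act_diff_left: "act (x - y) b = act x b - act y b"
  using act_add_left[of x "- y" b] act_scaleC_left[of "-1" y b] by (simp add: scaleC_minus_one)

lemma act_diff_right: "act x (b - c) = act x b - act x c"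
  using act_add_right[of x b "- c"] act_scaleC_right[of x "-1" c] by (simp add: scaleC_minus_one)

lemma norm_act_le: "norm (act x b) \<le> norm x * norm b"
proof (rule power2_le_imp_le)
  have "(norm (act x b))\<^sup>2 = norm (star b * (ip x x * b))"
    by (simp add: norm_square_ip ip_act_left ip_act_right mult.assoc)
  also have "\<dots> \<le> norm (star b) * (norm (ip x x) * norm b)"
    by (rule order.trans[OF norm_mult_ineq mult_left_mono[OF norm_mult_ineq]]) simp
  also have "\<dots> = (norm x * norm b)\<^sup>2"
    by (simp add: power_mult_distrib norm_square_ip[symmetric] power2_eq_square mult_ac)
  finally show "(norm (act x b))\<^sup>2 \<le> (norm x * norm b)\<^sup>2" .
qed simp

lemma Phi_star_Phi: "cadjoint (\<Phi> x) (\<Phi> y h) = \<phi> (ip x y) h"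
  using Phi_map by (metis comp_apply phi_map_def)

lemma cinner_Phi: "cinner (\<Phi> x g) (\<Phi> y h) = cinner g (\<phi> (ip x y) h)"
  by (simp add: cinner_cadjoint_right[OF Phi_ops, symmetric] Phi_star_Phi)

lemma linear_Phi_vec: "linear (\<Phi> x)"
  using Phi_ops[of x] bounded_linear.linear by (auto simp: bounded_ops_def)

text \<open>
  \<open>\<Phi>\<close> inherits linearity from \<open>\<phi>\<close>: the difference of both sides is orthogonal to every \<open>\<Phi> z g\<close>, and it
  is a combination of such vectors.
\<close>

lemma Phi_diff: "\<Phi> (x - y) h = \<Phi> x h - \<Phi> y h"
proof -
  define v where "v = \<Phi> (x - y) h - (\<Phi> x h - \<Phi> y h)"
  have "cinner (\<Phi> z g) v = 0" for z g
    by (simp add: v_def cinner_diff_right cinner_Phi ip_diff_right phi_diff)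
  then have "cinner v v = 0"
    by (subst (1) v_def) (simp add: cinner_diff_left)
  then show ?thesis
    by (simp add: cinner_self v_def)
qed

lemma Phi_scaleC: "\<Phi> (c *\<^sub>C x) h = c *\<^sub>C \<Phi> x h"
proof -
  define v where "v = \<Phi> (c *\<^sub>C x) h - c *\<^sub>C \<Phi> x h"
  have "cinner (\<Phi> z g) v = 0" for z g
    by (simp add: v_def cinner_diff_right cinner_Phi ip_scaleC_right phi_scaleC
        cinner_scaleC_right)
  then have "cinner v v = 0"
    by (subst (1) v_def) (simp add: cinner_diff_left cinner_scaleC_left)
  then show ?thesis
    by (simp add: cinner_self v_def)
qed

lemma Phi_add: "\<Phi> (x + y) h = \<Phi> x h + \<Phi> y h"
  using Phi_diff[of x "- y" h] Phi_scaleC[of "-1" y h] by (simp add: scaleC_minus_one)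

lemma phi_ip_selfadj: "cinner (\<phi> (ip x x) g) h = cinner g (\<phi> (ip x x) h)"
  using phi_star[of g "ip x x" h] by (simp add: star_ip)

text \<open>
  The difference \<open>v\<close> of both sides is orthogonal to the range of \<open>\<Phi> x\<close> by the first assumption and to
  \<open>\<Phi> (act x b) h\<close> by the second one, hence to itself.
\<close>

lemma module_eqI:
  fixes b :: 'a and h :: 'h
  assumes "\<phi> (ip x x * b) h = \<phi> (ip x x) (\<phi> b h)"
    and "cinner h (\<phi> (star b * (ip x x * b)) h) = cinner (\<phi> b h) (\<phi> (ip x x) (\<phi> b h))"
  shows "\<Phi> (act x b) h = \<Phi> x (\<phi> b h)"
proof -
  define v where "v = \<Phi> (act x b) h - \<Phi> x (\<phi> b h)"
  have "cinner (\<Phi> x g) v = 0" for g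
    by (simp add: v_def cinner_diff_right cinner_Phi ip_act_right assms(1))
  moreover have "cinner (\<Phi> (act x b) h) v = 0"
  proof -
    have "cinner h (\<phi> (star b * ip x x) (\<phi> b h)) = cinner (\<phi> (ip x x * b) h) (\<phi> b h)"
      using phi_star[of h "ip x x * b" "\<phi> b h"] by (simp add: star_mult star_ip)
    then show ?thesis
      by (simp add: v_def cinner_diff_right cinner_Phi ip_act_right ip_act_left assms mult.assoc
          phi_ip_selfadj)
  qed
  ultimately have "cinner v v = 0"
    by (subst (1) v_def) (simp add: cinner_diff_left)
  then show ?thesis
    by (simp add: cinner_self v_def)
qed

lemma module_domainD: "x \<in> module_domain act \<phi> \<Phi> \<Longrightarrow> \<Phi> (act x b) h = \<Phi> x (\<phi> b h)"
  by (simp add: module_domain_def)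

lemma module_domainI: "(\<And>b h. \<Phi> (act x b) h = \<Phi> x (\<phi> b h)) \<Longrightarrow> x \<in> module_domain act \<phi> \<Phi>"
  by (auto simp: module_domain_def)

text \<open>
  Write \<open>a = ip x x\<close>. Pairing \<open>\<Phi> x\<close> with \<open>\<Phi> (act x b)\<close> factorises \<open>\<phi> (a b)\<close>, taking adjoints
  factorises \<open>\<phi> (b a)\<close>, and pairing \<open>\<Phi> (act x b\<^sup>*)\<close> with \<open>\<Phi> (act x c)\<close> factorises \<open>\<phi> (b a c)\<close>.
  Adjoints of \<open>\<phi> (b\<^sup>*)\<close> become \<open>\<phi> b\<close> because \<open>\<phi>\<close> preserves adjoints.
\<close>

lemma ternary_if_module_domain:
  assumes x: "x \<in> module_domain act \<phi> \<Phi>"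
  shows "ip x x \<in> ternary_domain \<phi>"
proof -
  let ?a = "ip x x"
  note eq = module_domainD[OF x]
  have ab: "\<phi> (?a * b) h = \<phi> ?a (\<phi> b h)" for b h
    by (metis Phi_star_Phi eq ip_act_right)
  have ba: "\<phi> (b * ?a) h = \<phi> b (\<phi> ?a h)" for b h
  proof (rule eq_if_cinner_eq)
    fix z
    have "cinner z (\<phi> (b * ?a) h) = cinner (\<phi> (?a * star b) z) h"
      using phi_star[of z "?a * star b" h] by (simp add: star_mult star_star star_ip)
    also have "\<dots> = cinner z (\<phi> b (\<phi> ?a h))"
      using phi_star[of z "star b" "\<phi> ?a h"] by (simp add: ab star_star phi_ip_selfadj)
    finally show "cinner z (\<phi> (b * ?a) h) = cinner z (\<phi> b (\<phi> ?a h))" .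
  qed
  have bac: "\<phi> (b * ?a * c) h = \<phi> b (\<phi> ?a (\<phi> c h))" for b c h
  proof (rule eq_if_cinner_eq)
    fix z
    have "cinner z (\<phi> (b * ?a * c) h) = cinner (\<Phi> (act x (star b)) z) (\<Phi> (act x c) h)"
      by (simp add: cinner_Phi ip_act_left ip_act_right star_star mult.assoc)
    also have "\<dots> = cinner (\<phi> (star b) z) (\<phi> ?a (\<phi> c h))"
      by (simp add: eq cinner_Phi)
    also have "\<dots> = cinner z (\<phi> b (\<phi> ?a (\<phi> c h)))"
      using phi_star[of z "star b"] by (simp add: star_star)
    finally show "cinner z (\<phi> (b * ?a * c) h) = cinner z (\<phi> b (\<phi> ?a (\<phi> c h)))" .
  qed
  show ?thesis
    by (simp add: ternary_domain_def mult_domain_def fun_eq_iff ab ba bac cadjoint_phi star_ip)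
qed

lemma module_domain_if_ternary:
  assumes "ip x x \<in> ternary_domain \<phi>"
  shows "x \<in> module_domain act \<phi> \<Phi>"
proof (rule module_domainI)
  fix b h
  let ?a = "ip x x"
  from assms have "\<phi> (?a * b) h = \<phi> ?a (\<phi> b h)"
    and "\<phi> (star b * (?a * b)) h = \<phi> (star b) (\<phi> ?a (\<phi> b h))"
    by (simp_all add: ternary_domain_def mult_domain_def fun_eq_iff cadjoint_phi star_ip mult.assoc)
  then show "\<Phi> (act x b) h = \<Phi> x (\<phi> b h)"
    by (intro module_eqI) (simp_all add: phi_star)
qed

text \<open>
  The adjoint \<open>(\<Phi> y)\<^sup>* \<Phi> z\<close> is \<open>\<phi> (ip y z)\<close>, so the claim is an instance of \<open>module_eqI\<close> at
  \<open>c = ip y z\<close>. Its assumptions hold because \<open>ip x x * c = ip (act y (ip x x)) z\<close> and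
  \<open>c\<^sup>* * (ip x x * c) = ip z (act y (ip x x * c))\<close> let the module property act at \<open>y\<close>.
\<close>

lemma module_domain_subset_ternary:
  "module_domain act \<phi> \<Phi> \<subseteq> module_ternary_domain act ip \<Phi>"
proof
  fix y assume "y \<in> module_domain act \<phi> \<Phi>"
  note eq = module_domainD[OF this]
  have "\<Phi> (act x (ip y z)) h = \<Phi> x (\<phi> (ip y z) h)" for x z h
  proof (rule module_eqI)
    let ?c = "ip y z" and ?a = "ip x x"
    have ac: "\<phi> (?a * ?c) h = \<phi> ?a (\<phi> ?c h)"
    proof (rule eq_if_cinner_eq)
      fix g
      have "cinner g (\<phi> (?a * ?c) h) = cinner (\<Phi> (act y ?a) g) (\<Phi> z h)"
        by (simp add: cinner_Phi ip_act_left star_ip)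
      then show "cinner g (\<phi> (?a * ?c) h) = cinner g (\<phi> ?a (\<phi> ?c h))"
        by (simp add: eq cinner_Phi phi_ip_selfadj)
    qed
    then show "\<phi> (?a * ?c) h = \<phi> ?a (\<phi> ?c h)" .
    have "cinner h (\<phi> (star ?c * (?a * ?c)) h) = cinner (\<Phi> z h) (\<Phi> (act y (?a * ?c)) h)"
      by (simp add: cinner_Phi ip_act_right star_ip)
    also have "\<dots> = cinner h (\<phi> (star ?c) (\<phi> (?a * ?c) h))"
      by (simp add: eq cinner_Phi star_ip)
    finally show "cinner h (\<phi> (star ?c * (?a * ?c)) h) = cinner (\<phi> ?c h) (\<phi> ?a (\<phi> ?c h))"
      by (simp add: phi_star ac)
  qed
  then show "y \<in> module_ternary_domain act ip \<Phi>"
    by (auto simp: module_ternary_domain_def fun_eq_iff Phi_star_Phi)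
qed

text \<open>
  The converse bookkeeping: for \<open>c = ip x z\<close> one has \<open>ip y y * c = ip (act x (ip y y)) z\<close> and
  \<open>c\<^sup>* * (ip y y * c) = ip z (act x (ip y (act y c)))\<close>, and the ternary property applies to both.
\<close>

lemma ternary_imp_ip_tests:
  assumes "y \<in> module_ternary_domain act ip \<Phi>"
  shows "\<Phi> (act y (ip x z)) h = \<Phi> y (\<phi> (ip x z) h)"
proof (rule module_eqI)
  have eq: "\<Phi> (act x (ip y z)) h = \<Phi> x (\<phi> (ip y z) h)" for x z h
    using assms by (auto simp: module_ternary_domain_def fun_eq_iff Phi_star_Phi)
  let ?c = "ip x z" and ?a = "ip y y"
  have ac: "\<phi> (?a * ?c) h = \<phi> ?a (\<phi> ?c h)"
  proof (rule eq_if_cinner_eq)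
    fix g
    have "cinner g (\<phi> (?a * ?c) h) = cinner (\<Phi> (act x ?a) g) (\<Phi> z h)"
      by (simp add: cinner_Phi ip_act_left star_ip)
    then show "cinner g (\<phi> (?a * ?c) h) = cinner g (\<phi> ?a (\<phi> ?c h))"
      by (simp add: eq cinner_Phi phi_ip_selfadj)
  qed
  then show "\<phi> (?a * ?c) h = \<phi> ?a (\<phi> ?c h)" .
  have "cinner h (\<phi> (star ?c * (?a * ?c)) h) = cinner (\<Phi> z h) (\<Phi> (act x (ip y (act y ?c))) h)"
    by (simp add: cinner_Phi ip_act_right star_ip)
  also have "\<dots> = cinner h (\<phi> (star ?c) (\<phi> (?a * ?c) h))"
    using eq[of x "act y ?c" h] by (simp add: cinner_Phi star_ip ip_act_right)
  finally show "cinner h (\<phi> (star ?c * (?a * ?c)) h) = cinner (\<phi> ?c h) (\<phi> ?a (\<phi> ?c h))"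
    by (simp add: phi_star ac)
qed

text \<open>
  The matrix entry \<open>D\<close> of \<open>\<Phi> (act x d) - \<Phi> x \<phi> d\<close> depends linearly and continuously on \<open>d\<close>, and it vanishes
  on a dense subspace.
\<close>

lemma module_domain_if_full:
  assumes full: "full_module ip"
    and test: "\<And>y z h. \<Phi> (act x (ip y z)) h = \<Phi> x (\<phi> (ip y z) h)"
  shows "x \<in> module_domain act \<phi> \<Phi>"
proof (rule module_domainI, rule eq_if_cinner_eq)
  fix b h l
  define D where "D d = cinner l (\<Phi> (act x d) h - \<Phi> x (\<phi> d h))" for d
  have D_diff: "D (c - d) = D c - D d" for c d
    by (simp add: D_def act_diff_right Phi_diff phi_diff linear_diff[OF linear_Phi_vec]
        cinner_diff_right)
  have D_span: "D d = 0" if "d \<in> span {ip y z | y z. True}" for d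
    using that
  proof (induction rule: span_induct_alt)
    case base
    show ?case using D_diff[of 0 0] by simp
  next
    case (step r d' d)
    then obtain y z where "d' = ip y z" by blast
    then have "r *\<^sub>R d' = ip y (complex_of_real r *\<^sub>C z)"
      by (simp add: ip_scaleC_right scaleR_scaleC)
    then have "D (r *\<^sub>R d') = 0"
      by (simp add: D_def test)
    then show ?case
      using step D_diff[of "r *\<^sub>R d' + d" d] by simp
  qed
  obtain b' where b': "\<And>n. b' n \<in> span {ip y z | y z. True}" "b' \<longlonglongrightarrow> b"
    using full unfolding full_module_def by (metis UNIV_I closure_sequential)
  obtain C where C: "C \<ge> 0" "\<And>d. cmod (cinner h (\<phi> d h)) \<le> C * norm d"
    using phi_weakly_bounded[of h h] by metis
  obtain C' where C': "\<And>d. cmod (cinner (cadjoint (\<Phi> x) l) (\<phi> d h)) \<le> C' * norm d"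
    using phi_weakly_bounded[of "cadjoint (\<Phi> x) l" h] by metis
  have bound: "cmod (D d) \<le> (norm l * (sqrt C * norm x) + C') * norm d" for d
  proof -
    have "(norm (\<Phi> (act x d) h))\<^sup>2 = cmod (cinner h (\<phi> (ip (act x d) (act x d)) h))"
      by (simp add: cinner_Phi[symmetric] cinner_self norm_power)
    also have "\<dots> \<le> C * (norm (act x d))\<^sup>2"
      using C(2) by (simp add: norm_square_ip)
    also have "\<dots> \<le> C * (norm x * norm d)\<^sup>2"
      using C(1) norm_act_le by (simp add: mult_left_mono)
    also have "\<dots> = (sqrt C * norm x * norm d)\<^sup>2"
      using C(1) by (simp add: power_mult_distrib)
    finally have "norm (\<Phi> (act x d) h) \<le> sqrt C * norm x * norm d"
      by (rule power2_le_imp_le) (simp add: C(1))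
    then have "cmod (cinner l (\<Phi> (act x d) h)) \<le> norm l * (sqrt C * norm x * norm d)"
      using cauchy_schwarz_cinner order_trans mult_left_mono norm_ge_zero by meson
    moreover have "cmod (cinner l (\<Phi> x (\<phi> d h))) \<le> C' * norm d"
      using C' by (simp add: cadjoint_cinner[OF Phi_ops])
    ultimately show ?thesis
      unfolding D_def cinner_diff_right
      using norm_triangle_ineq4[of "cinner l (\<Phi> (act x d) h)" "cinner l (\<Phi> x (\<phi> d h))"]
      by (simp add: algebra_simps)
  qed
  have "(\<lambda>n. D b) \<longlonglongrightarrow> 0"
  proof (rule Lim_null_comparison)
    show "\<forall>\<^sub>F n in sequentially. norm (D b) \<le> (norm l * (sqrt C * norm x) + C') * norm (b - b' n)"
      using bound[of "b - b' n" for n] by (simp add: D_diff D_span[OF b'(1)])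
    have "(\<lambda>n. norm (b - b' n)) \<longlonglongrightarrow> norm (b - b)"
      by (intro tendsto_intros b'(2))
    then show "(\<lambda>n. (norm l * (sqrt C * norm x) + C') * norm (b - b' n)) \<longlonglongrightarrow> 0"
      by (intro tendsto_mult_right_zero) simp
  qed
  then have "D b = 0"
    using LIMSEQ_const_iff by blast
  then show "cinner l (\<Phi> (act x b) h) = cinner l (\<Phi> x (\<phi> b h))"
    by (simp add: D_def cinner_diff_right)
qed

end

locale contractive_module_map = cp_module_map + contractive_cp_map
begin

lemma norm_Phi_le: "norm (\<Phi> x h) \<le> norm x * norm h"
proof (rule power2_le_imp_le)
  have "(norm (\<Phi> x h))\<^sup>2 = cmod (cinner h (\<phi> (ip x x) h))"
    by (simp add: cinner_Phi[symmetric] cinner_self norm_power)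
  also have "\<dots> \<le> (norm x * norm h)\<^sup>2"
    using cmod_cinner_phi_le[of h "ip x x" h]
    by (simp add: norm_square_ip[symmetric] power_mult_distrib power2_eq_square mult_ac)
  finally show "(norm (\<Phi> x h))\<^sup>2 \<le> (norm x * norm h)\<^sup>2" .
qed simp

lemma norm_cadjoint_Phi_le: "norm (cadjoint (\<Phi> x) l) \<le> norm x * norm l"
proof -
  let ?k = "cadjoint (\<Phi> x) l"
  have "(norm ?k)\<^sup>2 = cmod (cinner l (\<Phi> x ?k))"
    by (simp add: cadjoint_cinner[OF Phi_ops, symmetric] cinner_self norm_power)
  also have "\<dots> \<le> norm l * (norm x * norm ?k)"
    by (rule order.trans[OF cauchy_schwarz_cinner mult_left_mono[OF norm_Phi_le]]) simp
  finally have "norm ?k * norm ?k \<le> (norm x * norm l) * norm ?k"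
    by (simp add: power2_eq_square mult_ac)
  then show ?thesis
    by (cases "?k = 0") auto
qed

text \<open>
  Fix \<open>l\<close> and put \<open>k = (\<Phi> x)\<^sup>* l\<close>. For an approximate unit \<open>e\<close> of \<open>a = ip x x\<close> in \<open>a A\<close> the tests give
  \<open>\<Phi> (act x (e b)) = \<Phi> x \<phi> (e b)\<close>, so only \<open>\<langle>k, \<phi> ((1 - e) b) h\<rangle> \<rightarrow> 0\<close> is at stake. Up to a small
  error \<open>b\<close> may be replaced by \<open>u b\<close> with \<open>u\<close> self-adjoint in the unit ball, and then
  \<open>\<bar>\<langle>k, \<phi> ((1 - e) u b) h\<rangle>\<bar>\<^sup>2 \<le> \<langle>k, \<phi> ((1 - e) u\<^sup>2 (1 - e)) k\<rangle> \<langle>h, \<phi> (b\<^sup>* b) h\<rangle>\<close>. The first factor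
  tends to \<open>0\<close>, because \<open>\<langle>k, \<phi> (c - e c) k\<rangle> \<rightarrow> 0\<close> for bounded \<open>c\<close>.
\<close>

lemma module_domain_if_contractive:
  assumes test: "\<And>y z h. \<Phi> (act x (ip y z)) h = \<Phi> x (\<phi> (ip y z) h)"
  shows "x \<in> module_domain act \<phi> \<Phi>"
proof (rule module_domainI, rule eq_if_cinner_eq)
  fix b h l
  define a where "a = ip x x"
  have a: "star a = a"
    by (simp add: a_def star_ip)
  obtain e where e: "\<And>n. star (e n) = e n" "\<And>n. norm (e n) \<le> 1" "\<And>n. \<exists>f. e n = a * f"
    and e_lim: "(\<lambda>n. a - e n * a) \<longlonglongrightarrow> 0"
    and e_comm: "\<And>n. e n * a = a * e n"
    and e_contr: "\<And>n y. norm (y - e n * y) \<le> norm y"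
    by (rule selfadj_approx_unit[OF a]) (erule that, assumption+)
  define k where "k = cadjoint (\<Phi> x) l"
  have k: "cinner k w = cinner l (\<Phi> x w)" for w
    by (simp add: k_def cadjoint_cinner[OF Phi_ops])
  \<comment> \<open>The right ideal generated by \<open>a\<close> consists of inner products.\<close>
  have eq: "\<Phi> (act x (e n * c)) g = \<Phi> x (\<phi> (e n * c) g)" for n c g
  proof -
    obtain f where "e n = a * f" using e by blast
    then have "e n * c = ip x (act x (f * c))"
      by (simp add: a_def ip_act_right mult.assoc)
    then show ?thesis by (simp add: test)
  qed
  have eq1: "\<Phi> (act x (e n)) g = \<Phi> x (\<phi> (e n) g)" for n g
  proof -
    obtain f where "e n = a * f" using e by blast
    then have "e n = ip x (act x f)"
      by (simp add: a_def ip_act_right)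
    then show ?thesis by (simp add: test)
  qed
  define y where "y n = x - act x (e n)" for n
  have y_lim: "(\<lambda>n. norm (y n)) \<longlonglongrightarrow> 0"
  proof (rule tendsto_norm_zero, rule tendsto_zero_if_norm_square, rule Lim_null_comparison)
    have "(norm (y n))\<^sup>2 \<le> 2 * norm (a - e n * a)" for n
    proof -
      let ?d = "a - e n * a"
      have "ip (y n) (y n) = ?d - ?d * e n"
        by (simp add: y_def ip_diff_left ip_diff_right ip_act_left ip_act_right e a_def
            left_diff_distrib mult.assoc)
      then have "(norm (y n))\<^sup>2 \<le> norm ?d + norm ?d * norm (e n)"
        unfolding norm_square_ip
        using norm_triangle_ineq4[of ?d "?d * e n"] norm_mult_ineq[of ?d "e n"] by simp
      also have "\<dots> \<le> norm ?d + norm ?d * 1"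
        by (intro add_left_mono mult_left_mono e) simp
      finally show ?thesis by simp
    qed
    then show "\<forall>\<^sub>F n in sequentially. norm ((norm (y n))\<^sup>2) \<le> 2 * norm (a - e n * a)"
      by simp
    show "(\<lambda>n. 2 * norm (a - e n * a)) \<longlonglongrightarrow> 0"
      by (rule tendsto_mult_right_zero[OF tendsto_norm_zero[OF e_lim]])
  qed
  \<comment> \<open>Taking adjoints in \<open>\<Phi> (act x e) = \<Phi> x \<phi> e\<close> shows that \<open>\<phi> e k = (\<Phi> (act x e))\<^sup>* l\<close>.\<close>
  have phi_e_k: "\<phi> (e n) k = k - cadjoint (\<Phi> (y n)) l" for n
  proof (rule eq_if_cinner_eq)
    fix w
    have "cinner (\<phi> (e n) k) w = cinner k w - cinner l (\<Phi> (y n) w)"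
      using phi_star[of k "e n" w]
      by (simp add: e k y_def Phi_diff eq1 cinner_diff_right)
    then have "cinner (\<phi> (e n) k) w = cinner (k - cadjoint (\<Phi> (y n)) l) w"
      by (simp add: cinner_diff_left cadjoint_cinner[OF Phi_ops])
    then show "cinner w (\<phi> (e n) k) = cinner w (k - cadjoint (\<Phi> (y n)) l)"
      by (metis cnj_cinner)
  qed
  have e_k_lim: "(\<lambda>n. \<phi> (e n) k) \<longlonglongrightarrow> k"
  proof -
    have "(\<lambda>n. cadjoint (\<Phi> (y n)) l) \<longlonglongrightarrow> 0"
    proof (rule Lim_null_comparison)
      show "\<forall>\<^sub>F n in sequentially. norm (cadjoint (\<Phi> (y n)) l) \<le> norm (y n) * norm l"
        by (simp add: norm_cadjoint_Phi_le)
      show "(\<lambda>n. norm (y n) * norm l) \<longlonglongrightarrow> 0"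
        by (rule tendsto_mult_left_zero[OF y_lim])
    qed
    then have "(\<lambda>n. k - cadjoint (\<Phi> (y n)) l) \<longlonglongrightarrow> k - 0"
      by (intro tendsto_intros)
    then show ?thesis by (simp add: phi_e_k)
  qed
  have defect_lim: "(\<lambda>n. schwarz_defect \<phi> k (e n) (e n)) \<longlonglongrightarrow> 0"
  proof -
    have "cinner k (\<phi> (e n * e n) k) = cinner k k - cinner l (\<Phi> (y n + act (y n) (e n)) k)" for n
      by (simp add: k eq[symmetric] y_def Phi_add Phi_diff act_diff_left act_mult cinner_add_right
          cinner_diff_right)
    moreover have "(\<lambda>n. cinner l (\<Phi> (y n + act (y n) (e n)) k)) \<longlonglongrightarrow> 0"
    proof (rule Lim_null_comparison)
      have "cmod (cinner l (\<Phi> (y n + act (y n) (e n)) k)) \<le> (norm l * 2 * norm k) * norm (y n)" for n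
      proof -
        have "norm (y n + act (y n) (e n)) \<le> norm (y n) + norm (y n) * 1"
          using norm_triangle_ineq[of "y n" "act (y n) (e n)"] norm_act_le[of "y n" "e n"]
            mult_left_mono[OF e(2)[of n], of "norm (y n)"] by simp
        then have "norm (\<Phi> (y n + act (y n) (e n)) k) \<le> (2 * norm (y n)) * norm k"
          by (intro order.trans[OF norm_Phi_le] mult_right_mono) auto
        then have "norm l * norm (\<Phi> (y n + act (y n) (e n)) k) \<le> norm l * ((2 * norm (y n)) * norm k)"
          by (rule mult_left_mono) simp
        then show ?thesis
          using cauchy_schwarz_cinner[of l "\<Phi> (y n + act (y n) (e n)) k"] by (simp add: mult_ac)
      qed
      then show "\<forall>\<^sub>F n in sequentially. norm (cinner l (\<Phi> (y n + act (y n) (e n)) k))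
          \<le> (norm l * 2 * norm k) * norm (y n)"
        by simp
      show "(\<lambda>n. (norm l * 2 * norm k) * norm (y n)) \<longlonglongrightarrow> 0"
        by (rule tendsto_mult_right_zero[OF y_lim])
    qed
    ultimately have "(\<lambda>n. cinner k (\<phi> (e n * e n) k)) \<longlonglongrightarrow> cinner k k - 0"
      by (simp only:) (intro tendsto_intros)
    moreover have "(\<lambda>n. cinner (\<phi> (e n) k) (\<phi> (e n) k)) \<longlonglongrightarrow> cinner k k"
      unfolding cinner_self by (intro tendsto_intros e_k_lim)
    ultimately have "(\<lambda>n. schwarz_defect \<phi> k (e n) (e n)) \<longlonglongrightarrow> cinner k k - 0 - cinner k k"
      unfolding schwarz_defect_def e(1) by (rule tendsto_diff)
    then show ?thesis by simp
  qed
  \<comment> \<open>On \<open>k\<close> the approximate unit acts like a unit.\<close>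
  have absorb: "(\<lambda>n. cinner k (\<phi> (c n) k) - cinner k (\<phi> (e n * c n) k)) \<longlonglongrightarrow> 0"
    if c: "\<And>n. norm (c n) \<le> 1" for c
  proof -
    have ck: "norm (\<phi> (c n) k) \<le> norm k" for n
      using norm_phi_le[of "c n" k] mult_right_mono[OF c[of n], of "norm k"] by simp
    have "(\<lambda>n. schwarz_defect \<phi> k (e n) (c n)) \<longlonglongrightarrow> 0"
    proof (rule tendsto_zero_if_norm_square, rule Lim_null_comparison)
      have "(cmod (schwarz_defect \<phi> k (e n) (c n)))\<^sup>2
          \<le> cmod (schwarz_defect \<phi> k (e n) (e n)) * (norm k)\<^sup>2" for n
      proof -
        have "Re (schwarz_defect \<phi> k (c n) (c n)) \<le> Re (cinner k (\<phi> (star (c n) * c n) k))"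
          by (simp add: schwarz_defect_def cinner_self)
        also have "\<dots> \<le> norm k * norm (star (c n) * c n) * norm k"
          using cmod_cinner_phi_le complex_Re_le_cmod order_trans by blast
        also have "\<dots> \<le> norm k * 1 * norm k"
          using c by (intro mult_left_mono mult_right_mono) (auto simp: cstar_identity power_le_one)
        finally have "Re (schwarz_defect \<phi> k (c n) (c n)) \<le> (norm k)\<^sup>2"
          by (simp add: power2_eq_square)
        then have "Re (schwarz_defect \<phi> k (e n) (e n)) * Re (schwarz_defect \<phi> k (c n) (c n))
            \<le> cmod (schwarz_defect \<phi> k (e n) (e n)) * (norm k)\<^sup>2"
          using schwarz_defect_self_nonneg by (intro mult_mono complex_Re_le_cmod) auto
        then show ?thesis
          using schwarz_defect_cauchy_schwarz order_trans by blast
      qed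
      then show "\<forall>\<^sub>F n in sequentially. norm ((norm (schwarz_defect \<phi> k (e n) (c n)))\<^sup>2)
          \<le> cmod (schwarz_defect \<phi> k (e n) (e n)) * (norm k)\<^sup>2"
        by simp
      show "(\<lambda>n. cmod (schwarz_defect \<phi> k (e n) (e n)) * (norm k)\<^sup>2) \<longlonglongrightarrow> 0"
        by (rule tendsto_mult_left_zero[OF tendsto_norm_zero[OF defect_lim]])
    qed
    moreover have "(\<lambda>n. cinner (k - \<phi> (e n) k) (\<phi> (c n) k)) \<longlonglongrightarrow> 0"
    proof (rule Lim_null_comparison)
      show "\<forall>\<^sub>F n in sequentially. norm (cinner (k - \<phi> (e n) k) (\<phi> (c n) k))
          \<le> norm (k - \<phi> (e n) k) * norm k"
        using order.trans[OF cauchy_schwarz_cinner mult_left_mono[OF ck]] by simp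
      have "(\<lambda>n. norm (k - \<phi> (e n) k)) \<longlonglongrightarrow> norm (k - k)"
        by (intro tendsto_intros e_k_lim)
      then show "(\<lambda>n. norm (k - \<phi> (e n) k) * norm k) \<longlonglongrightarrow> 0"
        by (intro tendsto_mult_left_zero) simp
    qed
    ultimately have "(\<lambda>n. cinner (k - \<phi> (e n) k) (\<phi> (c n) k)
        - schwarz_defect \<phi> k (e n) (c n)) \<longlonglongrightarrow> 0 - 0"
      by (intro tendsto_diff)
    then show ?thesis
      by (simp add: schwarz_defect_def e cinner_diff_left)
  qed
  define v where "v = cinner l (\<Phi> (act x b) h) - cinner l (\<Phi> x (\<phi> b h))"
  have v: "v = cinner l (\<Phi> (act (y n) b) h) - cinner k (\<phi> (b - e n * b) h)" for n
    using eq[of n b h]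
    by (simp add: v_def k y_def act_diff_left act_mult[symmetric] Phi_diff phi_diff
        linear_diff[OF linear_Phi_vec] cinner_diff_right)
  have v_bound: "cmod v \<le> norm k * norm h * norm (b - u * b)"
    if u: "star u = u" "norm u \<le> 1" for u
  proof -
    define U where "U = u * u"
    have U: "norm U \<le> 1"
      using u by (simp add: U_def selfadj_norm_square power_le_one)
    have Ue: "norm (U * e n) \<le> 1" for n
      using norm_mult_ineq[of U "e n"] mult_le_one[OF U norm_ge_zero e(2)[of n]] by simp
    \<comment> \<open>This is \<open>u (1 - e)\<close>, so that \<open>w\<^sup>* w = (1 - e) U (1 - e)\<close>.\<close>
    define w where "w n = u - u * e n" for n
    have w: "star (w n) * w n = (U - e n * U) - (U * e n - e n * (U * e n))" for n
      by (simp add: w_def U_def star_diff star_mult u e left_diff_distrib right_diff_distrib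
          mult.assoc)
    have "(\<lambda>n. (cinner k (\<phi> U k) - cinner k (\<phi> (e n * U) k))
        - (cinner k (\<phi> (U * e n) k) - cinner k (\<phi> (e n * (U * e n)) k))) \<longlonglongrightarrow> 0 - 0"
      by (intro tendsto_diff absorb U Ue)
    then have w_lim: "(\<lambda>n. cinner k (\<phi> (star (w n) * w n) k)) \<longlonglongrightarrow> 0"
      by (simp add: w phi_diff cinner_diff_right)
    have wb_lim: "(\<lambda>n. cinner k (\<phi> (star (w n) * b) h)) \<longlonglongrightarrow> 0"
    proof (rule tendsto_zero_if_norm_square, rule Lim_null_comparison)
      let ?R = "Re (cinner h (\<phi> (star b * b) h))"
      have "0 \<le> ?R"
        using cp_positive[of h b] by (simp add: complex_nonneg_Reals_iff)
      then have "(cmod (cinner k (\<phi> (star (w n) * b) h)))\<^sup>2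
          \<le> cmod (cinner k (\<phi> (star (w n) * w n) k)) * ?R" for n
        by (intro order.trans[OF cp_cauchy_schwarz] mult_right_mono complex_Re_le_cmod)
      then show "\<forall>\<^sub>F n in sequentially. norm ((norm (cinner k (\<phi> (star (w n) * b) h)))\<^sup>2)
          \<le> cmod (cinner k (\<phi> (star (w n) * w n) k)) * ?R"
        by simp
      show "(\<lambda>n. cmod (cinner k (\<phi> (star (w n) * w n) k)) * ?R) \<longlonglongrightarrow> 0"
        by (rule tendsto_mult_left_zero[OF tendsto_norm_zero[OF w_lim]])
    qed
    have y_b_lim: "(\<lambda>n. cinner l (\<Phi> (act (y n) b) h)) \<longlonglongrightarrow> 0"
    proof (rule Lim_null_comparison)
      have "cmod (cinner l (\<Phi> (act (y n) b) h)) \<le> norm l * ((norm (y n) * norm b) * norm h)" for n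
        by (intro order.trans[OF cauchy_schwarz_cinner] mult_left_mono
            order.trans[OF norm_Phi_le] mult_right_mono norm_act_le) auto
      then show "\<forall>\<^sub>F n in sequentially. norm (cinner l (\<Phi> (act (y n) b) h))
          \<le> norm l * ((norm (y n) * norm b) * norm h)"
        by simp
      show "(\<lambda>n. norm l * ((norm (y n) * norm b) * norm h)) \<longlonglongrightarrow> 0"
        by (intro tendsto_mult_right_zero tendsto_mult_left_zero y_lim)
    qed
    have step: "cmod v \<le> cmod (cinner l (\<Phi> (act (y n) b) h))
        + cmod (cinner k (\<phi> (star (w n) * b) h)) + norm k * norm h * norm (b - u * b)" for n
    proof -
      let ?r = "b - u * b"
      have "b - e n * b = star (w n) * b + (?r - e n * ?r)"
        by (simp add: w_def star_diff star_mult u e left_diff_distrib right_diff_distrib mult.assoc)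
      then have "v = cinner l (\<Phi> (act (y n) b) h) - (cinner k (\<phi> (star (w n) * b) h)
          + cinner k (\<phi> (?r - e n * ?r) h))"
        by (simp only: v[of n] phi_add cinner_add_right)
      then have "cmod v \<le> cmod (cinner l (\<Phi> (act (y n) b) h))
          + (cmod (cinner k (\<phi> (star (w n) * b) h)) + cmod (cinner k (\<phi> (?r - e n * ?r) h)))"
        by (simp only:) (rule order.trans[OF norm_triangle_ineq4 add_left_mono[OF norm_triangle_ineq]])
      moreover have "cmod (cinner k (\<phi> (?r - e n * ?r) h)) \<le> norm k * norm ?r * norm h"
        by (rule order.trans[OF cmod_cinner_phi_le])
          (intro mult_right_mono mult_left_mono e_contr norm_ge_zero)
      ultimately show ?thesis
        by (simp add: mult_ac)
    qed
    have "(\<lambda>n. cmod (cinner l (\<Phi> (act (y n) b) h))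
        + cmod (cinner k (\<phi> (star (w n) * b) h)) + norm k * norm h * norm (b - u * b))
        \<longlonglongrightarrow> 0 + 0 + norm k * norm h * norm (b - u * b)"
      by (intro tendsto_add tendsto_const tendsto_norm_zero y_b_lim wb_lim)
    then have "cmod v \<le> 0 + 0 + norm k * norm h * norm (b - u * b)"
      using step by (intro LIMSEQ_le_const) auto
    then show ?thesis by simp
  qed
  obtain u where u: "\<And>n. star (u n) = u n" "\<And>n. norm (u n) \<le> 1"
    and u_lim: "(\<lambda>n. b - u n * b) \<longlonglongrightarrow> 0"
    using left_approx_unit[of b] by metis
  have "(\<lambda>n. v) \<longlonglongrightarrow> 0"
  proof (rule Lim_null_comparison)
    show "\<forall>\<^sub>F n in sequentially. norm v \<le> norm k * norm h * norm (b - u n * b)"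
      using v_bound[OF u] by simp
    show "(\<lambda>n. norm k * norm h * norm (b - u n * b)) \<longlonglongrightarrow> 0"
      by (rule tendsto_mult_right_zero[OF tendsto_norm_zero[OF u_lim]])
  qed
  then have "v = 0"
    using LIMSEQ_const_iff by blast
  then show "cinner l (\<Phi> (act x b) h) = cinner l (\<Phi> x (\<phi> b h))"
    by (simp add: v_def)
qed

text \<open>
  The test gives \<open>\<phi> (a a) = (\<Phi> x)\<^sup>* \<Phi> (act x a) = \<phi> a \<phi> a\<close> for \<open>a = ip x x\<close>, and the converse is
  \<open>module_eqI\<close> at \<open>b = a\<close>.
\<close>

lemma self_test_iff_mult_domain:
  "\<Phi> (act x (ip x x)) = \<Phi> x \<circ> \<phi> (ip x x) \<longleftrightarrow> ip x x \<in> mult_domain \<phi>"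
proof
  let ?a = "ip x x"
  assume "\<Phi> (act x ?a) = \<Phi> x \<circ> \<phi> ?a"
  then have "\<phi> (?a * ?a) h = \<phi> ?a (\<phi> ?a h)" for h
    by (metis Phi_star_Phi comp_apply ip_act_right)
  then show "?a \<in> mult_domain \<phi>"
    by (intro mult_domain_if_square) (auto simp: star_ip)
next
  let ?a = "ip x x"
  assume "?a \<in> mult_domain \<phi>"
  then have ab: "\<phi> (?a * b) h = \<phi> ?a (\<phi> b h)" for b h
    by (simp add: mult_domain_def)
  have "\<Phi> (act x ?a) h = \<Phi> x (\<phi> ?a h)" for h
    by (rule module_eqI) (simp_all add: ab star_ip phi_ip_selfadj)
  then show "\<Phi> (act x ?a) = \<Phi> x \<circ> \<phi> ?a"
    by auto
qed

end

theorem proposition3p5: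
  fixes act :: "'x::complex_banach \<Rightarrow> 'a::cstar_algebra \<Rightarrow> 'x"
    and ip :: "'x \<Rightarrow> 'x \<Rightarrow> 'a"
    and \<phi> :: "'a \<Rightarrow> 'h::complex_hilbert \<Rightarrow> 'h"
    and \<Phi> :: "'x \<Rightarrow> 'h \<Rightarrow> 'k::complex_hilbert"
    and x0 :: 'x
  assumes "hilbert_module act ip"
    and "\<forall>a. \<phi> a \<in> bounded_ops"
    and "linear_op_map \<phi>"
    and "completely_positive \<phi>"
    and "\<forall>x. \<Phi> x \<in> bounded_ops"
    and "phi_map ip \<phi> \<Phi>"
  shows "(x0 \<in> module_domain act \<phi> \<Phi> \<longleftrightarrow> ip x0 x0 \<in> ternary_domain \<phi>) \<and>
         (x0 \<in> module_domain act \<phi> \<Phi> \<longrightarrow>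
           (\<forall>y z. \<Phi> (act x0 (ip y z)) = \<Phi> x0 \<circ> \<phi> (ip y z))) \<and>
         (full_module ip \<or> contractive \<phi> \<longrightarrow>
           (x0 \<in> module_domain act \<phi> \<Phi> \<longleftrightarrow>
             (\<forall>y z. \<Phi> (act x0 (ip y z)) = \<Phi> x0 \<circ> \<phi> (ip y z)))) \<and>
         module_domain act \<phi> \<Phi> \<subseteq> module_ternary_domain act ip \<Phi> \<and>
         (full_module ip \<or> contractive \<phi> \<longrightarrow>
           module_domain act \<phi> \<Phi> = module_ternary_domain act ip \<Phi>) \<and>
         (contractive \<phi> \<longrightarrow>
           (\<Phi> (act x0 (ip x0 x0)) = \<Phi> x0 \<circ> \<phi> (ip x0 x0) \<longleftrightarrow>
             ip x0 x0 \<in> mult_domain \<phi>))"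
proof -
  interpret hilbert_module act ip by (rule assms(1))
  interpret cp_module_map act ip \<phi> \<Phi>
    by unfold_locales (use assms in auto)
  have contractive: "contractive_module_map act ip \<phi> \<Phi>" if "contractive \<phi>"
    using that by unfold_locales
  have tests: "x \<in> module_domain act \<phi> \<Phi>"
    if "full_module ip \<or> contractive \<phi>"
      and "\<And>y z h. \<Phi> (act x (ip y z)) h = \<Phi> x (\<phi> (ip y z) h)" for x
    using that module_domain_if_full
      contractive_module_map.module_domain_if_contractive[OF contractive] by blast
  have one: "x0 \<in> module_domain act \<phi> \<Phi> \<longleftrightarrow> ip x0 x0 \<in> ternary_domain \<phi>"
    using ternary_if_module_domain module_domain_if_ternary by blast
  have two: "\<forall>y z. \<Phi> (act x0 (ip y z)) = \<Phi> x0 \<circ> \<phi> (ip y z)"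
    if "x0 \<in> module_domain act \<phi> \<Phi>"
    using that by (simp add: module_domain_def)
  have two': "x0 \<in> module_domain act \<phi> \<Phi>"
    if "full_module ip \<or> contractive \<phi>"
      and "\<forall>y z. \<Phi> (act x0 (ip y z)) = \<Phi> x0 \<circ> \<phi> (ip y z)"
    using tests[OF that(1)] that(2) by simp
  have three: "module_ternary_domain act ip \<Phi> \<subseteq> module_domain act \<phi> \<Phi>"
    if "full_module ip \<or> contractive \<phi>"
    using tests[OF that] ternary_imp_ip_tests by blast
  have four: "\<Phi> (act x0 (ip x0 x0)) = \<Phi> x0 \<circ> \<phi> (ip x0 x0) \<longleftrightarrow> ip x0 x0 \<in> mult_domain \<phi>"
    if "contractive \<phi>"
    by (rule contractive_module_map.self_test_iff_mult_domain[OF contractive[OF that]])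
  show ?thesis
    using one two two' three four module_domain_subset_ternary by blast
qed

end
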